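(* Let $N\ge2$ be an integer, $\mu>0$ and $\beta>0$. The continuous-time $(\mu,((j+1)^\beta),N)$-random walk on $\Omega_N$ has degree $\gamma=\mu-1$, and it has degree $\gamma^-$ if and only if $\beta\le\mu^{-1}$. In this case, as $t\to\infty$, for some positive constants, $$g_t^{(\mu)}\sim\mathrm{const}\,\log\log t\quad\text{if }\beta=\mu^{-1},\qquad g_t^{(\mu)}\sim\mathrm{const}\,(\log t)^{1-\beta\mu}\quad\text{if }0<\beta<\mu^{-1}.$$
   Context: $\Omega_N=\{x=(x_1,x_2,\dots): x_i\in\mathbb Z_N,\ x_i\ne0 \text{ for only finitely many } i\}$ with $\mathbb Z_N$ the cyclic group of order $N$ and componentwise addition mod $N$; $|x|=\max\{i:x_i\ne0\}$ for $x\neq 0$ and $|0|=0$. Given a probability distribution $(r_j)_{j\ge1}$ on $\{1,2,\dots\}$ with all $r_j>0$, the $r_j$-random walk on $\Omega_N$ has i.i.d. steps $\eta$ with $\mathbb P[\eta=y]=\frac{r_{|y|}}{N^{|y|-1}(N-1)}$ for $y\neq0$ and $\mathbb P[\eta=0]=0$; its continuous-time version has unit-rate exponential holding times and transition probability $p_t(x,y)$. The $(\mu,(c_j),N)$-random walk is the $r_j$-random walk with $r_j=D\,c_{j-1}N^{-(j-1)/\mu}$, $j\ge1$, $D$ being the normalizing constant; here $c_j=(j+1)^\beta$, $j\ge0$. With $G^{\zeta}\varphi=\frac1{\Gamma(\zeta)}\int_0^\infty t^{\zeta-1}T_t\varphi\,dt$ ($\zeta>0$, $T_t$ the semigroup),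 the degree is $\gamma=\sup\{\zeta>-1:G^{\zeta+1}\varphi<\infty$ for all finitely supported $\varphi\ge0\}$; by irreducibility $G^{\zeta+1}\varphi<\infty$ for all such $\varphi$ iff $\int_0^\infty t^{\zeta}p_t(0,0)\,dt<\infty$. The degree is $\gamma^-$ if $G^{\gamma+1}\varphi\equiv\infty$ for all such $\varphi\ne0$, and $\gamma^+$ if $G^{\gamma+1}\varphi<\infty$ for all such $\varphi$. Finally $g_t^{(\mu)}=\frac1{\Gamma(\mu)}\int_0^ts^{\mu-1}p_s(0,0)\,ds$. *)

theory Defs
  imports
    "HOL-Probability.Probability"
    "HOL-Algebra.Product_Groups"
    "HOL-Algebra.Elementary_Groups"
    "HOL-Library.Landau_Symbols"
begin

text \<open>Coordinates are indexed by 1, 2, ...; as elements of a direct sum in the library's sense, points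
  are functions with value \<^const>\<open>undefined\<close> at index 0.\<close>

definition hier_group :: "nat \<Rightarrow> (nat \<Rightarrow> int) monoid" where
  "hier_group N = sum_group {1..} (\<lambda>_. integer_mod_group N)"

abbreviation Omega :: "nat \<Rightarrow> (nat \<Rightarrow> int) set" where
  "Omega N \<equiv> carrier (hier_group N)"

abbreviation origin :: "nat \<Rightarrow> nat \<Rightarrow> int" where
  "origin N \<equiv> \<one>\<^bsub>hier_group N\<^esub>"

definition hnorm :: "(nat \<Rightarrow> int) \<Rightarrow> nat" where
  "hnorm x = Max (insert 0 {i \<in> {1..}. x i \<noteq> 0})"

definition step_prob :: "nat \<Rightarrow> (nat \<Rightarrow> real) \<Rightarrow> (nat \<Rightarrow> int) \<Rightarrow> real" where
  "step_prob N r y =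
     (if y = origin N then 0
      else r (hnorm y) / (real N ^ (hnorm y - 1) * (real N - 1)))"

definition step_law :: "nat \<Rightarrow> (nat \<Rightarrow> real) \<Rightarrow> (nat \<Rightarrow> int) measure" where
  "step_law N r = point_measure (Omega N) (\<lambda>y. ennreal (step_prob N r y))"

definition holding_law :: "real measure" where
  "holding_law = density lborel (\<lambda>s. ennreal (exponential_density 1 s))"

text \<open>The canonical probability space: a sample point is a pair \<open>(\<eta>, \<tau>)\<close> of a sequence of
  i.i.d. steps and an independent sequence of i.i.d. holding times.\<close>

definition walk_space :: "nat \<Rightarrow> (nat \<Rightarrow> real) \<Rightarrow> ((nat \<Rightarrow> nat \<Rightarrow> int) \<times> (nat \<Rightarrow> real)) measure" where
  "walk_space N r =
     (\<Pi>\<^sub>M n\<in>(UNIV :: nat set). step_law N r) \<Otimes>\<^sub>M (\<Pi>\<^sub>M n\<in>(UNIV :: nat set). holding_law)"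

primrec skeleton :: "nat \<Rightarrow> (nat \<Rightarrow> int) \<Rightarrow> (nat \<Rightarrow> nat \<Rightarrow> int) \<Rightarrow> nat \<Rightarrow> (nat \<Rightarrow> int)" where
  "skeleton N x \<eta> 0 = x"
| "skeleton N x \<eta> (Suc n) = skeleton N x \<eta> n \<otimes>\<^bsub>hier_group N\<^esub> \<eta> n"

text \<open>The set below is infinite only on a null event, where the cardinality is 0 by convention.\<close>

definition jumps :: "(nat \<Rightarrow> real) \<Rightarrow> real \<Rightarrow> nat" where
  "jumps \<tau> t = card {n. (\<Sum>i\<le>n. \<tau> i) \<le> t}"

definition walk :: "nat \<Rightarrow> (nat \<Rightarrow> int) \<Rightarrow> real \<Rightarrow> (nat \<Rightarrow> nat \<Rightarrow> int) \<times> (nat \<Rightarrow> real) \<Rightarrow> (nat \<Rightarrow> int)" where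
  "walk N x t = (\<lambda>(\<eta>, \<tau>). skeleton N x \<eta> (jumps \<tau> t))"

definition walk_trans :: "nat \<Rightarrow> (nat \<Rightarrow> real) \<Rightarrow> real \<Rightarrow> (nat \<Rightarrow> int) \<Rightarrow> (nat \<Rightarrow> int) \<Rightarrow> real" where
  "walk_trans N r t x y =
     measure (walk_space N r) {\<omega> \<in> space (walk_space N r). walk N x t \<omega> = y}"

definition mu_rate :: "real \<Rightarrow> (nat \<Rightarrow> real) \<Rightarrow> nat \<Rightarrow> nat \<Rightarrow> real" where
  "mu_rate \<mu> c N j =
     (let D = 1 / (\<Sum>i. c i * real N powr (- real i / \<mu>))
      in D * c (j - 1) * real N powr (- real (j - 1) / \<mu>))"

definition mu_trans ::
    "real \<Rightarrow> (nat \<Rightarrow> real) \<Rightarrow> nat \<Rightarrow> real \<Rightarrow> (nat \<Rightarrow> int) \<Rightarrow> (nat \<Rightarrow> int) \<Rightarrow> real" where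
  "mu_trans \<mu> c N = walk_trans N (mu_rate \<mu> c N)"

text \<open>Here \<open>S\<close> is a state space and \<open>p t x y\<close> a transition function on it.\<close>

definition semigroup_op ::
    "'s set \<Rightarrow> (real \<Rightarrow> 's \<Rightarrow> 's \<Rightarrow> real) \<Rightarrow> real \<Rightarrow> ('s \<Rightarrow> real) \<Rightarrow> 's \<Rightarrow> real" where
  "semigroup_op S p t \<phi> x = (\<Sum>\<^sub>\<infinity>y\<in>S. p t x y * \<phi> y)"

definition potential ::
    "'s set \<Rightarrow> (real \<Rightarrow> 's \<Rightarrow> 's \<Rightarrow> real) \<Rightarrow> real \<Rightarrow> ('s \<Rightarrow> real) \<Rightarrow> 's \<Rightarrow> ennreal" where
  "potential S p \<zeta> \<phi> x =
     ennreal (1 / Gamma \<zeta>) *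
     (\<integral>\<^sup>+ t\<in>{0..}. ennreal (t powr (\<zeta> - 1) * semigroup_op S p t \<phi> x) \<partial>lborel)"

definition test_funs :: "'s set \<Rightarrow> ('s \<Rightarrow> real) set" where
  "test_funs S = {\<phi>. (\<forall>x\<in>S. 0 \<le> \<phi> x) \<and> finite {x \<in> S. \<phi> x \<noteq> 0}}"

definition transience_degree :: "'s set \<Rightarrow> (real \<Rightarrow> 's \<Rightarrow> 's \<Rightarrow> real) \<Rightarrow> ereal" where
  "transience_degree S p =
     Sup (ereal ` {\<zeta>. \<zeta> > -1 \<and> (\<forall>\<phi>\<in>test_funs S. \<forall>x\<in>S. potential S p (\<zeta> + 1) \<phi> x < \<infinity>)})"

definition has_degree_minus :: "'s set \<Rightarrow> (real \<Rightarrow> 's \<Rightarrow> 's \<Rightarrow> real) \<Rightarrow> real \<Rightarrow> bool" where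
  "has_degree_minus S p \<gamma> \<longleftrightarrow>
     transience_degree S p = ereal \<gamma> \<and>
     (\<forall>\<phi>\<in>test_funs S. (\<exists>y\<in>S. \<phi> y \<noteq> 0) \<longrightarrow> (\<forall>x\<in>S. potential S p (\<gamma> + 1) \<phi> x = \<infinity>))"

definition incomplete_potential ::
    "(real \<Rightarrow> 's \<Rightarrow> 's \<Rightarrow> real) \<Rightarrow> 's \<Rightarrow> real \<Rightarrow> real \<Rightarrow> real" where
  "incomplete_potential p z \<mu> t =
     1 / Gamma \<mu> * (LINT s:{0..t}|lborel. s powr (\<mu> - 1) * p s z z)"

end

theory Submission
  imports Defs "HOL-Real_Asymp.Real_Asymp"
begin

text \<open>Uniform laws on balls are the convolution idempotents of \<open>\<Omega>\<^sub>N\<close>, so differences of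
  consecutive ones diagonalise every walk whose step law depends on the norm only:
  \<open>p\<^sub>t(0,0) = \<Sum>\<^sub>i (N - 1) N\<^sup>-\<^sup>i\<^sup>-\<^sup>1 exp (- h\<^sub>i t)\<close>, where
  \<open>h\<^sub>i\<close> is asymptotically a constant times \<open>(i + 1)\<^sup>\<beta> N\<^sup>-\<^sup>i\<^sup>/\<^sup>\<mu>\<close>. Integrating against
  \<open>t\<^sup>\<zeta>\<^sup>-\<^sup>1\<close> reduces finiteness of \<open>G\<^sup>\<zeta>\<close> to convergence of \<open>\<Sum>\<^sub>i N\<^sup>-\<^sup>i h\<^sub>i\<^sup>-\<^sup>\<zeta>\<close>, whose terms at
  \<open>\<zeta> = \<mu>\<close> behave like \<open>i\<^sup>-\<^sup>\<beta>\<^sup>\<mu>\<close>. The integral up to time \<open>t\<close> differs by a bounded amount from the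
  partial sum of this series up to \<open>i \<approx> \<mu> log\<^sub>N t\<close>. That error is dominated by geometric series, so
  the log-periodic oscillation of \<open>p\<^sub>t(0,0)\<close> does not affect the leading order.\<close>

section \<open>Balls and eigenfunctions\<close>

text \<open>The transition function is the law of a path built from i.i.d. steps and holding times,
  so the spectral formula is extracted from the path: a function that one step multiplies by
  \<open>1 - h\<close> is, by Fubini and the Poisson law of the number of jumps, multiplied by
  \<open>exp (- (h * t))\<close> in expectation. For the first mode \<open>1 - h\<close> is
  negative, hence the care about absolute convergence. The degree speaks of all test functions and
  all starting points. The passage from p_t(0,0) to p_t(x,y) is made mode by mode: modes of index at
  least the norm of x - y do not separate the two points, and each of the finitely many others
  changes the potential by a finite amount. At the critical exponent both regimes come from one
  argument with a free function \<open>L\<close>, a discrete primitive of i^(-\<beta>\<mu>) up to a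
  constant: ln (y + 1) in one case, y^(1 - \<beta>\<mu>) in the other.\<close>

locale hierarchical =
  fixes N :: nat
  assumes N_ge_2: "N \<ge> 2"
begin

abbreviation "G \<equiv> hier_group N"

lemma Omega_iff:
  "x \<in> Omega N \<longleftrightarrow> x \<in> ({1..} \<rightarrow>\<^sub>E {0..<int N}) \<and> finite {i \<in> {1..}. x i \<noteq> 0}"
  using N_ge_2 by (simp add: hier_group_def carrier_sum_group carrier_integer_mod_group)

lemma comm_group_hier: "comm_group G"
proof -
  interpret group G by (simp add: hier_group_def)
  show ?thesis
    by (rule group_comm_groupI) (auto simp: hier_group_def add.commute)
qed

sublocale comm_group G
  by (rule comm_group_hier)

lemma origin_apply: "i \<ge> 1 \<Longrightarrow> origin N i = 0"
  by (simp add: hier_group_def)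

text \<open>The range \<open>i > k\<close> never meets index 0, where a point has the value
  \<open>undefined\<close>; finiteness of the support makes the \<open>Max\<close> in
  \<open>hnorm\<close> meaningful.\<close>

lemma hnorm_le_iff:
  assumes "x \<in> Omega N"
  shows "hnorm x \<le> k \<longleftrightarrow> (\<forall>i>k. x i = 0)"
proof -
  have "hnorm x \<le> k \<longleftrightarrow> (\<forall>i\<in>{i \<in> {1..}. x i \<noteq> 0}. i \<le> k)"
    using assms by (simp add: hnorm_def Omega_iff)
  then show ?thesis
    by (simp add: Suc_le_eq) (metis gr_zeroI not_le not_less0)
qed

lemma hnorm_origin: "hnorm (origin N) = 0"
  using hnorm_le_iff[OF one_closed, of 0] by (simp add: origin_apply)

lemma hnorm_0_iff: "x \<in> Omega N \<Longrightarrow> hnorm x = 0 \<longleftrightarrow> x = origin N"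
proof -
  assume x: "x \<in> Omega N"
  have "x = origin N" if "\<forall>i>0. x i = 0"
  proof
    show "x i = origin N i" for i
      using x one_closed that origin_apply[of i]
      by (cases "i = 0") (auto simp: Omega_iff PiE_def extensional_def)
  qed
  then show ?thesis
    using hnorm_le_iff[OF x, of 0] hnorm_origin by auto
qed

lemma hnorm_mult_le:
  assumes "x \<in> Omega N" "y \<in> Omega N" "hnorm x \<le> k" "hnorm y \<le> k"
  shows "hnorm (x \<otimes>\<^bsub>G\<^esub> y) \<le> k"
  using assms m_closed[OF assms(1,2)]
  by (auto simp: hnorm_le_iff) (simp add: hier_group_def)

lemma hnorm_inv:
  assumes "x \<in> Omega N"
  shows "hnorm (inv\<^bsub>G\<^esub> x) = hnorm x"
proof -
  have le: "hnorm (inv\<^bsub>G\<^esub> y) \<le> hnorm y" if "y \<in> Omega N" for y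
  proof -
    have "y i \<in> carrier (integer_mod_group N)" if "i \<ge> 1" for i
      using \<open>y \<in> Omega N\<close> that by (auto simp: Omega_iff carrier_integer_mod_group)
    then have "(inv\<^bsub>G\<^esub> y) i = 0" if "i > hnorm y" for i
      using \<open>y \<in> Omega N\<close> that hnorm_le_iff[OF \<open>y \<in> Omega N\<close>, of "hnorm y"]
      by (simp add: hier_group_def)
    then show ?thesis
      using that by (simp add: hnorm_le_iff)
  qed
  show ?thesis
    using le[OF assms] le[OF inv_closed[OF assms]] assms by simp
qed

definition hball :: "nat \<Rightarrow> (nat \<Rightarrow> int) set" where
  "hball k = {x \<in> Omega N. hnorm x \<le> k}"

text \<open>A point of the ball is a free choice of \<open>k\<close> digits continued by
  zeros.\<close>

lemma card_hball: "card (hball k) = N ^ k"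
  and finite_hball: "finite (hball k)"
proof -
  let ?P = "{1..k} \<rightarrow>\<^sub>E {0..<int N}"
  let ?ext = "\<lambda>f. (\<lambda>i\<in>{1..}. if i \<le> k then f i else 0)"
  have "bij_betw ?ext ?P (hball k)"
  proof (rule bij_betw_byWitness[where f' = "\<lambda>x. restrict x {1..k}"])
    show "\<forall>f\<in>?P. restrict (?ext f) {1..k} = f"
      by (auto simp: fun_eq_iff PiE_def extensional_def restrict_def)
    show "\<forall>x\<in>hball k. ?ext (restrict x {1..k}) = x"
      by (auto simp: fun_eq_iff hball_def hnorm_le_iff Omega_iff PiE_def extensional_def restrict_def)
    show "?ext ` ?P \<subseteq> hball k"
    proof
      fix x assume "x \<in> ?ext ` ?P"
      then obtain f where f: "f \<in> ?P" "x = ?ext f" by blast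
      have "finite {i \<in> {1..}. x i \<noteq> 0}"
        by (rule finite_subset[of _ "{..k}"]) (auto simp: f split: if_splits)
      moreover have "x \<in> ({1..} \<rightarrow>\<^sub>E {0..<int N})"
        using f N_ge_2 by (auto simp: PiE_iff extensional_def)
      ultimately have "x \<in> Omega N" by (simp add: Omega_iff)
      then show "x \<in> hball k"
        by (auto simp: hball_def hnorm_le_iff f)
    qed
    show "(\<lambda>x. restrict x {1..k}) ` hball k \<subseteq> ?P"
      by (auto simp: hball_def Omega_iff)
  qed
  moreover have "finite ?P"
    by (intro finite_PiE) auto
  moreover have "card ?P = N ^ k"
    by (simp add: card_PiE)
  ultimately show "card (hball k) = N ^ k" "finite (hball k)"
    by (simp_all flip: bij_betw_same_card bij_betw_finite)
qed

lemma hball_mono: "i \<le> k \<Longrightarrow> hball i \<subseteq> hball k"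
  by (auto simp: hball_def)

lemma Omega_eq_UN_hball: "Omega N = (\<Union>k. hball k)"
  by (auto simp: hball_def)

lemma countable_Omega: "countable (Omega N)"
  unfolding Omega_eq_UN_hball using finite_hball by (auto intro: countable_finite)

lemma translate_hball:
  assumes w: "w \<in> Omega N"
  shows "{y \<in> Omega N. hnorm (w \<otimes>\<^bsub>G\<^esub> y) \<le> k} = (\<lambda>z. inv\<^bsub>G\<^esub> w \<otimes>\<^bsub>G\<^esub> z) ` hball k"
    (is "?L = ?R")
proof
  show "?L \<subseteq> ?R"
  proof
    fix y assume "y \<in> ?L"
    then have "w \<otimes>\<^bsub>G\<^esub> y \<in> hball k" "y = inv\<^bsub>G\<^esub> w \<otimes>\<^bsub>G\<^esub> (w \<otimes>\<^bsub>G\<^esub> y)"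
      using w by (auto simp: hball_def inv_solve_left)
    then show "y \<in> ?R" by blast
  qed
  show "?R \<subseteq> ?L"
    using w by (auto simp: hball_def m_assoc[symmetric])
qed

text \<open>A ball is a subgroup, so translation by one of its elements permutes it.\<close>

lemma translate_hball_inside:
  assumes w: "w \<in> Omega N" and "hnorm w \<le> k"
  shows "{y \<in> Omega N. hnorm (w \<otimes>\<^bsub>G\<^esub> y) \<le> k} = hball k"
proof -
  have "hnorm y \<le> k" if "y \<in> Omega N" "hnorm (w \<otimes>\<^bsub>G\<^esub> y) \<le> k" for y
  proof -
    have "y = inv\<^bsub>G\<^esub> w \<otimes>\<^bsub>G\<^esub> (w \<otimes>\<^bsub>G\<^esub> y)"
      using w that by (auto simp: inv_solve_left)
    then show ?thesis
      using hnorm_mult_le[of "inv\<^bsub>G\<^esub> w" "w \<otimes>\<^bsub>G\<^esub> y" k] w that assms by (simp add: hnorm_inv)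
  qed
  then show ?thesis
    using hnorm_mult_le[OF w _ assms(2)] by (auto simp: hball_def)
qed

text \<open>The isosceles property of an ultrametric: \<open>y\<close> is the inverse of
  \<open>w\<close> times an element of strictly smaller norm. It makes the step density constant on
  a translated ball that avoids the origin.\<close>

lemma hnorm_translate_outside:
  assumes w: "w \<in> Omega N" and k: "k < hnorm w"
    and y: "y \<in> Omega N" "hnorm (w \<otimes>\<^bsub>G\<^esub> y) \<le> k"
  shows "hnorm y = hnorm w"
proof (rule antisym)
  have "y \<in> {y \<in> Omega N. hnorm (w \<otimes>\<^bsub>G\<^esub> y) \<le> hnorm w}"
    using y k by auto
  then show "hnorm y \<le> hnorm w"
    using translate_hball_inside[OF w order_refl] by (simp add: hball_def)
  show "hnorm w \<le> hnorm y"
  proof (rule ccontr)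
    assume less: "\<not> hnorm w \<le> hnorm y"
    have "w = (w \<otimes>\<^bsub>G\<^esub> y) \<otimes>\<^bsub>G\<^esub> inv\<^bsub>G\<^esub> y"
      using w y by (simp add: m_assoc)
    then have "hnorm w \<le> max k (hnorm y)"
      using hnorm_mult_le[of "w \<otimes>\<^bsub>G\<^esub> y" "inv\<^bsub>G\<^esub> y" "max k (hnorm y)"] w y by (simp add: hnorm_inv)
    then show False using less k by simp
  qed
qed

lemma card_translate_hball:
  assumes w: "w \<in> Omega N"
  shows "card {y \<in> Omega N. hnorm (w \<otimes>\<^bsub>G\<^esub> y) \<le> k} = N ^ k"
  unfolding translate_hball[OF w]
  using w card_image[of "\<lambda>z. inv\<^bsub>G\<^esub> w \<otimes>\<^bsub>G\<^esub> z" "hball k"]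
  by (simp add: card_hball inj_on_def) (simp add: hball_def)

lemma finite_translate_hball:
  assumes w: "w \<in> Omega N"
  shows "finite {y \<in> Omega N. hnorm (w \<otimes>\<^bsub>G\<^esub> y) \<le> k}"
  unfolding translate_hball[OF w] by (simp add: finite_hball)

text \<open>Convolutions with \<open>unif i - unif (Suc i)\<close> are orthogonal projections onto common eigenspaces
  of all steps whose law depends on the norm only.\<close>

definition unif :: "nat \<Rightarrow> (nat \<Rightarrow> int) \<Rightarrow> real" where
  "unif k w = (if hnorm w \<le> k then 1 / real N ^ k else 0)"

definition eigenfun :: "nat \<Rightarrow> (nat \<Rightarrow> int) \<Rightarrow> real" where
  "eigenfun i w = unif i w - unif (Suc i) w"

lemma unif_bounds: "0 \<le> unif k w" "unif k w \<le> 1 / real N ^ k"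
  by (auto simp: unif_def)

lemma eigenfun_inside: "hnorm w \<le> i \<Longrightarrow> eigenfun i w = (real N - 1) / real N ^ Suc i"
  using N_ge_2 by (simp add: eigenfun_def unif_def field_simps)

lemma eigenfun_boundary: "hnorm w = Suc i \<Longrightarrow> eigenfun i w = - 1 / real N ^ Suc i"
  by (simp add: eigenfun_def unif_def)

lemma eigenfun_outside: "hnorm w > Suc i \<Longrightarrow> eigenfun i w = 0"
  by (simp add: eigenfun_def unif_def)

text \<open>The value inside the ball wins because N - 1 is at least 1. So every mode is largest at
  the origin, which later makes p_t(0,0) the maximum of the transition function.\<close>

lemma abs_eigenfun_le: "\<bar>eigenfun i w\<bar> \<le> (real N - 1) / real N ^ Suc i"
proof -
  consider "hnorm w \<le> i" | "hnorm w = Suc i" | "hnorm w > Suc i" by linarith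
  then show ?thesis
    using N_ge_2
    by cases (simp_all add: eigenfun_inside eigenfun_boundary eigenfun_outside divide_right_mono
        del: power_Suc)
qed

end

section \<open>One step of the walk acting on eigenfunctions\<close>

locale hierarchical_walk = hierarchical +
  fixes r :: "nat \<Rightarrow> real"
  assumes r_pos: "r (Suc i) > 0"
    and r_sums: "(\<lambda>i. r (Suc i)) sums 1"
begin

lemma step_prob_nonneg:
  assumes "y \<in> Omega N"
  shows "step_prob N r y \<ge> 0"
proof (cases "y = origin N")
  case False
  then obtain k where "hnorm y = Suc k"
    using assms hnorm_0_iff not0_implies_Suc by metis
  then show ?thesis
    using N_ge_2 r_pos[of k] by (simp add: step_prob_def)
qed (simp add: step_prob_def)

text \<open>The sphere of radius k + 1 has N^k (N - 1) points, which is exactly the denominator in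
  \<open>step_prob\<close>; each sphere thus carries mass \<open>r (Suc k)\<close>.\<close>

lemma sum_step_prob_hball: "(\<Sum>y\<in>hball k. step_prob N r y) = (\<Sum>i<k. r (Suc i))"
proof (induction k)
  case 0
  have "hball 0 = {origin N}"
    using hnorm_0_iff hnorm_origin by (auto simp: hball_def)
  then show ?case by (simp add: step_prob_def)
next
  case (Suc k)
  let ?S = "hball (Suc k) - hball k"
  have "real (card ?S) = real N ^ Suc k - real N ^ k"
    using card_Diff_subset[OF finite_hball hball_mono[of k "Suc k"]] card_mono[OF finite_hball hball_mono[of k "Suc k"]]
    by (simp add: card_hball of_nat_diff)
  then have card: "real (card ?S) = real N ^ k * (real N - 1)"
    by (simp add: algebra_simps)
  have "step_prob N r y = r (Suc k) / (real N ^ k * (real N - 1))" if "y \<in> ?S" for y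
  proof -
    have "hnorm y = Suc k" using that by (auto simp: hball_def)
    then show ?thesis using hnorm_origin by (auto simp: step_prob_def)
  qed
  then have "(\<Sum>y\<in>?S. step_prob N r y) = real (card ?S) * (r (Suc k) / (real N ^ k * (real N - 1)))"
    by simp
  also have "\<dots> = r (Suc k)"
    unfolding card using N_ge_2 by simp
  finally have "(\<Sum>y\<in>?S. step_prob N r y) = r (Suc k)" .
  then show ?case
    using sum.subset_diff[OF hball_mono[of k "Suc k"] finite_hball, of "step_prob N r"] Suc by simp
qed

lemma space_step_law [simp]: "space (step_law N r) = Omega N"
  and sets_step_law [simp]: "sets (step_law N r) = Pow (Omega N)"
  by (simp_all add: step_law_def space_point_measure sets_point_measure)

lemma emeasure_step_law_finite:
  assumes "finite A" "A \<subseteq> Omega N"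
  shows "emeasure (step_law N r) A = ennreal (\<Sum>y\<in>A. step_prob N r y)"
proof -
  have "emeasure (step_law N r) A = (\<Sum>y\<in>A. ennreal (step_prob N r y))"
    unfolding step_law_def using assms by (intro emeasure_point_measure_finite2) auto
  also have "\<dots> = ennreal (\<Sum>y\<in>A. step_prob N r y)"
    using assms step_prob_nonneg by (intro sum_ennreal) auto
  finally show ?thesis .
qed

lemma measure_step_law_finite:
  assumes "finite A" "A \<subseteq> Omega N"
  shows "measure (step_law N r) A = (\<Sum>y\<in>A. step_prob N r y)"
  using emeasure_step_law_finite[OF assms] assms step_prob_nonneg
  by (simp add: measure_def sum_nonneg subset_eq)

lemma prob_space_step_law: "prob_space (step_law N r)"
proof
  have "(\<lambda>k. emeasure (step_law N r) (hball k)) \<longlonglongrightarrow> emeasure (step_law N r) (\<Union>k. hball k)"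
    by (intro Lim_emeasure_incseq) (auto simp: incseq_def hball_def)
  moreover have "(\<lambda>k. emeasure (step_law N r) (hball k)) \<longlonglongrightarrow> ennreal 1"
  proof -
    have "emeasure (step_law N r) (hball k) = ennreal (\<Sum>i<k. r (Suc i))" for k
      using emeasure_step_law_finite[OF finite_hball[of k]] Omega_eq_UN_hball
      by (auto simp: sum_step_prob_hball)
    then show ?thesis
      using r_sums tendsto_ennrealI[of _ 1] by (simp add: sums_def del: ennreal_1)
  qed
  ultimately have "emeasure (step_law N r) (\<Union>k. hball k) = ennreal 1"
    by (rule LIMSEQ_unique)
  then show "emeasure (step_law N r) (space (step_law N r)) = 1"
    by (simp flip: Omega_eq_UN_hball)
qed

lemma measure_step_translate_inside:
  assumes "w \<in> Omega N" "hnorm w \<le> k"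
  shows "measure (step_law N r) {y \<in> Omega N. hnorm (w \<otimes>\<^bsub>G\<^esub> y) \<le> k} = (\<Sum>i<k. r (Suc i))"
proof -
  have "hball k \<subseteq> Omega N" by (auto simp: hball_def)
  then show ?thesis
    by (simp add: translate_hball_inside[OF assms] measure_step_law_finite finite_hball sum_step_prob_hball)
qed

text \<open>By \<open>hnorm_translate_outside\<close> all N^k points of the translated ball have the
  norm of \<open>w\<close>, hence equal step probability.\<close>

lemma measure_step_translate_outside:
  assumes "w \<in> Omega N" "k < hnorm w"
  shows "measure (step_law N r) {y \<in> Omega N. hnorm (w \<otimes>\<^bsub>G\<^esub> y) \<le> k}
    = real N ^ k * (r (hnorm w) / (real N ^ (hnorm w - 1) * (real N - 1)))"
proof -
  let ?A = "{y \<in> Omega N. hnorm (w \<otimes>\<^bsub>G\<^esub> y) \<le> k}"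
  have "step_prob N r y = r (hnorm w) / (real N ^ (hnorm w - 1) * (real N - 1))" if "y \<in> ?A" for y
  proof -
    have "hnorm y = hnorm w"
      using hnorm_translate_outside[OF assms] that by simp
    then show ?thesis
      using assms hnorm_origin by (auto simp: step_prob_def)
  qed
  then have "(\<Sum>y\<in>?A. step_prob N r y)
      = real (card ?A) * (r (hnorm w) / (real N ^ (hnorm w - 1) * (real N - 1)))"
    by simp
  moreover have "measure (step_law N r) ?A = (\<Sum>y\<in>?A. step_prob N r y)"
    by (rule measure_step_law_finite) (use finite_translate_hball assms in auto)
  ultimately show ?thesis
    by (simp add: card_translate_hball assms)
qed

text \<open>The eigenvalue of identity minus one-step operator on \<open>eigenfun i\<close>. The
  first two terms give the probability of a step of norm above \<open>i\<close>; the last one arises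
  because a step of norm \<open>i + 1\<close> from the centre lands where \<open>eigenfun i\<close>
  is -1 / (N - 1) times its central value.\<close>

definition decay :: "nat \<Rightarrow> real" where
  "decay i = 1 - (\<Sum>k<i. r (Suc k)) + r (Suc i) / (real N - 1)"

lemma integral_unif_step:
  assumes w: "w \<in> Omega N"
  shows "(\<integral>y. unif k (w \<otimes>\<^bsub>G\<^esub> y) \<partial>step_law N r)
    = measure (step_law N r) {y \<in> Omega N. hnorm (w \<otimes>\<^bsub>G\<^esub> y) \<le> k} / real N ^ k"
proof -
  interpret P: prob_space "step_law N r" by (rule prob_space_step_law)
  have "(\<integral>y. unif k (w \<otimes>\<^bsub>G\<^esub> y) \<partial>step_law N r)
    = (\<integral>y. indicator {y \<in> Omega N. hnorm (w \<otimes>\<^bsub>G\<^esub> y) \<le> k} y / real N ^ k \<partial>step_law N r)"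
    by (intro Bochner_Integration.integral_cong refl) (simp add: unif_def indicator_def)
  also have "\<dots> = measure (step_law N r) {y \<in> Omega N. hnorm (w \<otimes>\<^bsub>G\<^esub> y) \<le> k} / real N ^ k"
    by (subst Bochner_Integration.integral_divide_zero) (simp add: Int_absorb2)
  finally show ?thesis .
qed

lemma integrable_unif_step:
  "integrable (step_law N r) (\<lambda>y. unif k (w \<otimes>\<^bsub>G\<^esub> y))"
proof -
  interpret P: prob_space "step_law N r" by (rule prob_space_step_law)
  have "(\<lambda>y. unif k (w \<otimes>\<^bsub>G\<^esub> y)) \<in> borel_measurable (step_law N r)"
    by (auto simp: measurable_def)
  then show ?thesis
    by (intro P.integrable_const_bound[of _ "1 / real N ^ k"]) (auto simp: unif_bounds)
qed

lemma integral_eigenfun_step: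
  assumes w: "w \<in> Omega N"
  shows "(\<integral>y. eigenfun i (w \<otimes>\<^bsub>G\<^esub> y) \<partial>step_law N r) = (1 - decay i) * eigenfun i w"
proof -
  let ?m = "\<lambda>k. measure (step_law N r) {y \<in> Omega N. hnorm (w \<otimes>\<^bsub>G\<^esub> y) \<le> k}"
  have "(\<integral>y. eigenfun i (w \<otimes>\<^bsub>G\<^esub> y) \<partial>step_law N r) = ?m i / real N ^ i - ?m (Suc i) / real N ^ Suc i"
    unfolding eigenfun_def using integrable_unif_step integral_unif_step[OF w]
    by (subst Bochner_Integration.integral_diff) auto
  also have "\<dots> = (1 - decay i) * eigenfun i w"
  proof -
    consider "hnorm w \<le> i" | "hnorm w = Suc i" | "hnorm w > Suc i" by linarith
    then show ?thesis
    proof cases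
      case 1
      then show ?thesis
        using w N_ge_2 by (simp add: measure_step_translate_inside eigenfun_inside decay_def field_simps)
    next
      case 2
      then show ?thesis
        using w N_ge_2
        by (simp add: measure_step_translate_inside measure_step_translate_outside
            eigenfun_boundary decay_def field_simps)
    next
      \<comment> \<open>The step density is the same constant on both translated balls, so both
        averages equal it and cancel.\<close>
      case 3
      then show ?thesis
        using w N_ge_2 by (simp add: measure_step_translate_outside eigenfun_outside field_simps)
    qed
  qed
  finally show ?thesis .
qed

lemma sum_r_le_1: "(\<Sum>k<i. r (Suc k)) \<le> 1"
  using r_sums r_pos sum_le_suminf[of "\<lambda>k. r (Suc k)" "{..<i}"]
  by (auto simp: sums_iff intro: less_imp_le)

lemma decay_pos: "decay i > 0"
  using sum_r_le_1[of i] r_pos[of i] N_ge_2 by (simp add: decay_def add_nonneg_pos)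

end

section \<open>Spectral form of the transition function\<close>

lemma prob_space_holding_law: "prob_space holding_law"
  unfolding holding_law_def using prob_space_exponential_density[of 1] by simp

lemma space_holding_law [simp]: "space holding_law = UNIV"
  and sets_holding_law [simp, measurable_cong]: "sets holding_law = sets borel"
  by (simp_all add: holding_law_def)

interpretation holding: sequence_space holding_law
proof -
  interpret prob_space holding_law by (rule prob_space_holding_law)
  show "sequence_space holding_law"
    by unfold_locales
qed

definition arrival :: "nat \<Rightarrow> (nat \<Rightarrow> real) \<Rightarrow> real" where
  "arrival n \<tau> = (\<Sum>i\<le>n. \<tau> i)"

lemma measurable_arrival [measurable]: "arrival n \<in> borel_measurable holding.S"
  unfolding arrival_def by measurable

lemma measurable_jumps [measurable]: "(\<lambda>\<tau>. jumps \<tau> t) \<in> measurable holding.S (count_space UNIV)"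
proof -
  have "(\<lambda>\<tau>. jumps \<tau> t) -` {n} \<inter> space holding.S \<in> sets holding.S" for n
  proof -
    \<comment> \<open>The finite index set is coded by a list: lists form a countable type, so the
      event becomes a countable combination of arrival events. The first disjunct is the infinite
      case, where \<open>card\<close> is 0.\<close>
    have "jumps \<tau> t = n \<longleftrightarrow>
        (n = 0 \<and> \<not> (\<exists>m. \<forall>k. k > m \<longrightarrow> \<not> arrival k \<tau> \<le> t))
      \<or> (\<exists>ks :: nat list. card (set ks) = n \<and> (\<forall>k. arrival k \<tau> \<le> t \<longleftrightarrow> k \<in> set ks))" for \<tau>
    proof (cases "finite {k. arrival k \<tau> \<le> t}")
      case True
      then obtain ks where ks: "set ks = {k. arrival k \<tau> \<le> t}"
        using finite_list by blast
      obtain m where "\<forall>k\<in>{k. arrival k \<tau> \<le> t}. k \<le> m"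
        using True finite_nat_set_iff_bounded_le by blast
      then have "\<exists>m. \<forall>k. k > m \<longrightarrow> \<not> arrival k \<tau> \<le> t"
        by (intro exI[of _ m]) auto
      moreover have "(\<forall>k. arrival k \<tau> \<le> t \<longleftrightarrow> k \<in> set ks') \<longleftrightarrow> set ks' = set ks" for ks'
        using ks by auto
      moreover have "jumps \<tau> t = card (set ks)"
        by (simp add: jumps_def ks arrival_def)
      ultimately show ?thesis by auto
    next
      case False
      have "\<not> (\<exists>m. \<forall>k. k > m \<longrightarrow> \<not> arrival k \<tau> \<le> t)"
      proof
        assume "\<exists>m. \<forall>k. k > m \<longrightarrow> \<not> arrival k \<tau> \<le> t"
        then obtain m where "\<forall>k. k > m \<longrightarrow> \<not> arrival k \<tau> \<le> t" ..
        then have "{k. arrival k \<tau> \<le> t} \<subseteq> {..m}"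
          by (auto simp: not_less[symmetric])
        with False show False
          using finite_subset by blast
      qed
      moreover have "\<not> (\<forall>k. arrival k \<tau> \<le> t \<longleftrightarrow> k \<in> set ks)" for ks
      proof
        assume "\<forall>k. arrival k \<tau> \<le> t \<longleftrightarrow> k \<in> set ks"
        then have "{k. arrival k \<tau> \<le> t} = set ks" by auto
        with False show False by simp
      qed
      moreover have "jumps \<tau> t = 0"
        using False by (simp add: jumps_def arrival_def)
      ultimately show ?thesis by auto
    qed
    then have "(\<lambda>\<tau>. jumps \<tau> t) -` {n} \<inter> space holding.S = {\<tau> \<in> space holding.S.
        (n = 0 \<and> \<not> (\<exists>m. \<forall>k. k > m \<longrightarrow> \<not> arrival k \<tau> \<le> t))
      \<or> (\<exists>ks :: nat list. card (set ks) = n \<and> (\<forall>k. arrival k \<tau> \<le> t \<longleftrightarrow> k \<in> set ks))}"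
      by auto
    also have "\<dots> \<in> sets holding.S" by measurable
    finally show ?thesis .
  qed
  then show ?thesis
    by (simp add: measurable_count_space_eq2_countable)
qed

lemma indep_holding: "holding.indep_vars (\<lambda>_. borel) (\<lambda>i \<tau>. \<tau> i) {..n}"
proof -
  have comp: "distr holding.S borel (\<lambda>\<tau>. \<tau> i) = holding_law" for i
  proof -
    have "distr holding.S borel (\<lambda>\<tau>. \<tau> i) = distr holding.S holding_law (\<lambda>\<tau>. \<tau> i)"
      by (rule distr_cong) auto
    then show ?thesis using holding.PiM_component[of i] by simp
  qed
  have "distr holding.S (Pi\<^sub>M {..n} (\<lambda>_. borel)) (\<lambda>\<tau>. \<lambda>i\<in>{..n}. \<tau> i)
      = distr holding.S (Pi\<^sub>M {..n} (\<lambda>_. holding_law)) (\<lambda>\<tau>. restrict \<tau> {..n})"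
    by (intro distr_cong sets_PiM_cong) auto
  also have "\<dots> = Pi\<^sub>M {..n} (\<lambda>_. holding_law)"
    by (rule holding.distr_PiM_restrict_finite) auto
  finally show ?thesis
    by (subst holding.indep_vars_iff_distr_eq_PiM) (auto simp: comp)
qed

lemma distributed_holding:
  "distributed holding.S lborel (\<lambda>\<tau>. \<tau> i) (\<lambda>s. ennreal (exponential_density 1 s))"
proof -
  have "distr holding.S lborel (\<lambda>\<tau>. \<tau> i) = distr holding.S holding_law (\<lambda>\<tau>. \<tau> i)"
    by (rule distr_cong) auto
  then show ?thesis
    using holding.PiM_component[of i] by (auto simp: distributed_def holding_law_def)
qed

definition poisson_weight :: "real \<Rightarrow> nat \<Rightarrow> real" where
  "poisson_weight t n = t ^ n * exp (- t) / fact n"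

lemma poisson_weight_sums: "poisson_weight t sums 1"
  using sums_mult[OF exp_converges[of t], of "exp (- t)"]
  by (simp add: poisson_weight_def[abs_def] field_simps exp_minus)

text \<open>\<open>arrival n\<close> adds \<open>n + 1\<close> holding times and is therefore Erlang
  of index \<open>n\<close>; the subtracted Poisson sum is the probability of at most
  \<open>n\<close> jumps by time \<open>t\<close>.\<close>

lemma prob_arrival_le:
  assumes "t \<ge> 0"
  shows "holding.prob {\<tau> \<in> space holding.S. arrival n \<tau> \<le> t} = 1 - (\<Sum>m<Suc n. poisson_weight t m)"
proof -
  have "distributed holding.S lborel (arrival n) (\<lambda>s. ennreal (erlang_density n 1 s))"
    using holding.exponential_distributed_sum[of "{..n}" 1 "\<lambda>i \<tau>. \<tau> i"] distributed_holding indep_holding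
    by (simp add: arrival_def[abs_def])
  from holding.erlang_distributed_le[OF this _ assms] assms show ?thesis
    by (simp add: erlang_CDF_def poisson_weight_def lessThan_Suc_atMost)
qed

lemma AE_holding_pos: "AE \<tau> in holding.S. \<forall>i. \<tau> i > 0"
proof -
  have "AE s in holding_law. s > 0"
  proof -
    have "AE s in lborel. s \<noteq> (0::real)"
      by (rule AE_lborel_singleton)
    then show ?thesis
      unfolding holding_law_def
      by (subst AE_density) (auto simp: exponential_density_def elim: eventually_mono)
  qed
  then show ?thesis
    by (subst AE_all_countable) (auto intro!: AE_PiM_component prob_space_holding_law)
qed

text \<open>The exceptional event lies below every Poisson tail. This excludes the infinite case of
  the cardinality in \<open>jumps\<close>.\<close>

lemma AE_arrival_unbounded:
  assumes "t \<ge> 0"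
  shows "AE \<tau> in holding.S. \<exists>n. arrival n \<tau> > t"
proof -
  let ?A = "{\<tau> \<in> space holding.S. \<forall>n. arrival n \<tau> \<le> t}"
  have A: "?A \<in> sets holding.S" by measurable
  have le: "holding.prob ?A \<le> 1 - (\<Sum>m<Suc n. poisson_weight t m)" for n
    unfolding prob_arrival_le[OF assms, symmetric]
    by (intro holding.finite_measure_mono) auto
  have "(\<lambda>n. 1 - (\<Sum>m<Suc n. poisson_weight t m)) \<longlonglongrightarrow> 1 - 1"
    using poisson_weight_sums[of t]
    by (intro tendsto_intros LIMSEQ_Suc) (simp add: sums_def)
  then have "holding.prob ?A \<le> 0"
    using le by (intro LIMSEQ_le_const) auto
  then have "?A \<in> null_sets holding.S"
    using A by (simp add: null_sets_def holding.emeasure_eq_measure measure_le_0_iff)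
  then show ?thesis
    by (rule AE_I') (auto simp: not_less)
qed

text \<open>Positive holding times make arrivals increasing, so the set counted by
  \<open>jumps\<close> is an initial segment ending at the first arrival after
  \<open>t\<close>.\<close>

lemma jumps_eq_iff:
  assumes pos: "\<And>i. \<tau> i > 0" and unbounded: "\<exists>n. arrival n \<tau> > t"
  shows "jumps \<tau> t = n \<longleftrightarrow> (\<forall>i<n. arrival i \<tau> \<le> t) \<and> \<not> arrival n \<tau> \<le> t"
proof -
  have "strict_mono (\<lambda>i. arrival i \<tau>)"
    using pos by (simp add: strict_mono_Suc_iff arrival_def)
  then have mono: "arrival i \<tau> \<le> arrival j \<tau>" if "i \<le> j" for i j
    using that by (auto dest: strict_mono_mono monoD)
  have jumps: "jumps \<tau> t = m" if "\<forall>i<m. arrival i \<tau> \<le> t" "\<not> arrival m \<tau> \<le> t" for m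
  proof -
    have "i < m" if "arrival i \<tau> \<le> t" for i
      using that mono[of m i] \<open>\<not> arrival m \<tau> \<le> t\<close> by (meson leI order_trans)
    then have "{i. arrival i \<tau> \<le> t} = {..<m}"
      using that by auto
    then show ?thesis by (simp add: jumps_def arrival_def)
  qed
  define m where "m = (LEAST m. arrival m \<tau> > t)"
  have "\<not> arrival m \<tau> \<le> t"
    unfolding m_def not_le using unbounded by (rule LeastI_ex)
  moreover have "\<forall>i<m. arrival i \<tau> \<le> t"
    using not_less_Least[of _ "\<lambda>m. arrival m \<tau> > t"] by (simp add: m_def not_less)
  ultimately show ?thesis
    using jumps[of m] jumps[of n] by blast
qed

text \<open>\<open>F m\<close> is the event of at least \<open>m\<close> jumps. Almost surely it
  depends on the last arrival alone, so its probability is a Poisson tail, and consecutive tails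
  differ by one weight.\<close>

lemma prob_jumps:
  assumes "t \<ge> 0"
  shows "holding.prob {\<tau> \<in> space holding.S. jumps \<tau> t = n} = poisson_weight t n"
proof -
  define F where "F m = {\<tau> \<in> space holding.S. \<forall>i<m. arrival i \<tau> \<le> t}" for m
  have F_sets [measurable]: "F m \<in> sets holding.S" for m
    unfolding F_def by measurable
  have prob_F: "holding.prob (F m) = 1 - (\<Sum>k<m. poisson_weight t k)" for m
  proof (cases m)
    case 0
    then show ?thesis by (simp add: F_def holding.P.prob_space)
  next
    case (Suc k)
    have "holding.prob (F m) = holding.prob {\<tau> \<in> space holding.S. arrival k \<tau> \<le> t}"
    proof (rule holding.finite_measure_eq_AE)
      show "AE \<tau> in holding.S. \<tau> \<in> F m \<longleftrightarrow> \<tau> \<in> {\<tau> \<in> space holding.S. arrival k \<tau> \<le> t}"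
        using AE_holding_pos
      proof eventually_elim
        case (elim \<tau>)
        have "arrival i \<tau> \<le> arrival k \<tau>" if "i < m" for i
          unfolding arrival_def using elim that Suc
          by (intro sum_mono2) (auto intro: less_imp_le)
        then show ?case using Suc by (force simp: F_def)
      qed
    qed auto
    then show ?thesis by (simp only: prob_arrival_le[OF assms] Suc)
  qed
  have "holding.prob {\<tau> \<in> space holding.S. jumps \<tau> t = n} = holding.prob (F n - F (Suc n))"
  proof (rule holding.finite_measure_eq_AE)
    show "AE \<tau> in holding.S. \<tau> \<in> {\<tau> \<in> space holding.S. jumps \<tau> t = n} \<longleftrightarrow> \<tau> \<in> F n - F (Suc n)"
      using AE_holding_pos AE_arrival_unbounded[OF assms]
    proof eventually_elim
      case (elim \<tau>)
      then have "jumps \<tau> t = n \<longleftrightarrow> (\<forall>i<n. arrival i \<tau> \<le> t) \<and> \<not> arrival n \<tau> \<le> t"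
        by (intro jumps_eq_iff) auto
      then show ?case by (auto simp: F_def less_Suc_eq)
    qed
  qed auto
  also have "\<dots> = holding.prob (F n) - holding.prob (F (Suc n))"
    by (rule holding.finite_measure_Diff) (auto simp: F_def)
  finally show ?thesis by (simp add: prob_F)
qed

lemma integral_jumps:
  fixes f :: "nat \<Rightarrow> real"
  assumes "t \<ge> 0" and "(\<lambda>n. poisson_weight t n * \<bar>f n\<bar>) sums B"
    and sums: "(\<lambda>n. poisson_weight t n * f n) sums A"
  shows "(\<integral>\<tau>. f (jumps \<tau> t) \<partial>holding.S) = A"
proof -
  let ?D = "density (count_space UNIV) (\<lambda>n. ennreal (poisson_weight t n))"
  have "distr holding.S (count_space UNIV) (\<lambda>\<tau>. jumps \<tau> t) = ?D"
  proof (rule measure_eqI_countable)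
    show "emeasure (distr holding.S (count_space UNIV) (\<lambda>\<tau>. jumps \<tau> t)) {n} = emeasure ?D {n}"
      for n
    proof -
      have "(\<lambda>\<tau>. jumps \<tau> t) -` {n} \<inter> space holding.S = {\<tau> \<in> space holding.S. jumps \<tau> t = n}"
        by auto
      then have "emeasure (distr holding.S (count_space UNIV) (\<lambda>\<tau>. jumps \<tau> t)) {n}
        = ennreal (poisson_weight t n)"
        using prob_jumps[OF assms(1), of n] by (simp add: emeasure_distr holding.emeasure_eq_measure)
      then show ?thesis
        by (simp add: emeasure_density nn_integral_indicator_singleton)
    qed
  qed auto
  then have "(\<integral>\<tau>. f (jumps \<tau> t) \<partial>holding.S) = (\<integral>n. f n \<partial>?D)"
    using integral_distr[of "\<lambda>\<tau>. jumps \<tau> t" holding.S "count_space UNIV" f] by simp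
  also have "\<dots> = (\<integral>n. poisson_weight t n * f n \<partial>count_space UNIV)"
    using assms by (subst integral_density) (auto simp: poisson_weight_def)
  also have "\<dots> = A"
  proof -
    have "integrable (count_space UNIV) (\<lambda>n. poisson_weight t n * f n)"
      using assms by (simp add: integrable_count_space_nat_iff abs_mult poisson_weight_def sums_iff)
    then show ?thesis
      using sums_integral_count_space_nat sums sums_unique2 by blast
  qed
  finally show ?thesis .
qed

text \<open>The Poisson generating function, for \<open>z\<close> of either sign: it is applied to
  \<open>1 - decay i\<close>, and \<open>1 - decay 0\<close> is negative. The series in
  \<open>\<bar>z\<bar>\<close> supplies integrability.\<close>

lemma integral_power_jumps:
  assumes "t \<ge> 0"
  shows "(\<integral>\<tau>. z ^ jumps \<tau> t \<partial>holding.S) = exp (- ((1 - z) * t))"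
proof (rule integral_jumps[OF assms])
  have *: "(\<lambda>n. poisson_weight t n * y ^ n) sums exp (- ((1 - y) * t))" for y
    using sums_mult[OF exp_converges[of "y * t"], of "exp (- t)"]
    by (simp add: poisson_weight_def field_simps exp_diff exp_minus power_mult_distrib)
  show "(\<lambda>n. poisson_weight t n * z ^ n) sums exp (- ((1 - z) * t))"
    by (rule *)
  show "(\<lambda>n. poisson_weight t n * \<bar>z ^ n\<bar>) sums exp (- ((1 - \<bar>z\<bar>) * t))"
    using *[of "\<bar>z\<bar>"] by (simp add: power_abs)
qed

section \<open>Expectations along the path\<close>

context hierarchical_walk
begin

sublocale step: prob_space "step_law N r"
  by (rule prob_space_step_law)

sublocale steps: sequence_space "step_law N r"
  by unfold_locales

lemma measurable_skeleton [measurable]: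
  assumes "x \<in> Omega N"
  shows "(\<lambda>\<eta>. skeleton N x \<eta> n) \<in> measurable steps.S (count_space (Omega N))"
proof (induction n)
  case (Suc n)
  have "(\<lambda>\<eta>. \<eta> n) \<in> measurable steps.S (step_law N r)" by measurable
  then have coord: "(\<lambda>\<eta>. \<eta> n) \<in> measurable steps.S (count_space (Omega N))"
    by (subst measurable_cong_sets[OF refl, of _ "step_law N r"]) auto
  have "(\<lambda>\<eta>. z \<otimes>\<^bsub>G\<^esub> \<eta> n) \<in> measurable steps.S (count_space (Omega N))" if "z \<in> Omega N" for z
    using measurable_compose[OF coord, of "\<lambda>y. z \<otimes>\<^bsub>G\<^esub> y" "count_space (Omega N)"] that
    by auto
  then show ?case
    using measurable_compose_countable'[OF _ Suc countable_Omega, of "\<lambda>z \<eta>. z \<otimes>\<^bsub>G\<^esub> \<eta> n"] by simp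
qed (use assms in simp)

text \<open>\<open>skeleton\<close> recurses on the last step, whereas \<open>PiM_iter\<close>
  adjoins a new first coordinate; this identity moves the first step into the starting
  point.\<close>

lemma skeleton_case_nat:
  "skeleton N x (case_nat s \<omega>) (Suc n) = skeleton N (x \<otimes>\<^bsub>G\<^esub> s) \<omega> n"
  by (induction n) simp_all

text \<open>Conditioning on the first step replaces \<open>x\<close> by a neighbour, hence the
  induction over all starting points. The bound \<open>B\<close> gives the integrability that Fubini
  asks for.\<close>

lemma integral_skeleton:
  fixes f :: "(nat \<Rightarrow> int) \<Rightarrow> real"
  assumes bound: "\<And>z. \<bar>f z\<bar> \<le> B"
    and step: "\<And>z. z \<in> Omega N \<Longrightarrow> (\<integral>s. f (z \<otimes>\<^bsub>G\<^esub> s) \<partial>step_law N r) = c * f z"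
    and "x \<in> Omega N"
  shows "(\<integral>\<eta>. f (skeleton N x \<eta> n) \<partial>steps.S) = c ^ n * f x"
  using \<open>x \<in> Omega N\<close>
proof (induction n arbitrary: x)
  case 0
  then show ?case by (simp add: steps.P.prob_space)
next
  case (Suc n)
  interpret pair: pair_prob_space "step_law N r" steps.S ..
  have "f \<in> borel_measurable (count_space (Omega N))" by simp
  note meas [measurable] = measurable_compose[OF measurable_skeleton[OF Suc.prems] this]
  have "(\<integral>\<eta>. f (skeleton N x \<eta> (Suc n)) \<partial>steps.S)
      = (\<integral>\<eta>. f (skeleton N x \<eta> (Suc n))
          \<partial>distr (step_law N r \<Otimes>\<^sub>M steps.S) steps.S (\<lambda>(s, \<omega>). case_nat s \<omega>))"
    by (simp only: steps.PiM_iter)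
  also have "\<dots> = (\<integral>p. f (skeleton N x (case_nat (fst p) (snd p)) (Suc n)) \<partial>(step_law N r \<Otimes>\<^sub>M steps.S))"
    by (subst integral_distr) (auto simp: split_beta' simp del: skeleton.simps)
  also have "\<dots> = (\<integral>s. (\<integral>\<omega>. f (skeleton N x (case_nat s \<omega>) (Suc n)) \<partial>steps.S) \<partial>step_law N r)"
  proof (subst pair.integral_fst'[symmetric])
    show "integrable (step_law N r \<Otimes>\<^sub>M steps.S)
        (\<lambda>p. f (skeleton N x (case_nat (fst p) (snd p)) (Suc n)))"
      using bound by (intro pair.integrable_const_bound[of _ B]) (auto simp del: skeleton.simps)
  qed simp
  also have "\<dots> = (\<integral>s. c ^ n * f (x \<otimes>\<^bsub>G\<^esub> s) \<partial>step_law N r)"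
    using Suc by (intro Bochner_Integration.integral_cong refl) (simp add: skeleton_case_nat del: skeleton.simps)
  also have "\<dots> = c ^ Suc n * f x"
    using step[OF Suc.prems] by simp
  finally show ?case .
qed

sublocale path: pair_prob_space steps.S holding.S ..

lemma walk_space_eq: "walk_space N r = steps.S \<Otimes>\<^sub>M holding.S"
  by (simp add: walk_space_def)

lemma measurable_walk:
  assumes "x \<in> Omega N"
  shows "walk N x t \<in> measurable (walk_space N r) (count_space (Omega N))"
proof -
  note [measurable] = measurable_skeleton[OF assms]
  have "(\<lambda>p. skeleton N x (fst p) (jumps (snd p) t))
      \<in> measurable (steps.S \<Otimes>\<^sub>M holding.S) (count_space (Omega N))"
    by (rule measurable_compose_countable) measurable
  then show ?thesis
    by (simp add: walk_def walk_space_eq split_beta')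
qed

lemma integrable_walk:
  fixes f :: "(nat \<Rightarrow> int) \<Rightarrow> real"
  assumes bound: "\<And>z. \<bar>f z\<bar> \<le> B" and "x \<in> Omega N"
  shows "integrable (walk_space N r) (\<lambda>\<omega>. f (walk N x t \<omega>))"
proof -
  have "f \<in> borel_measurable (count_space (Omega N))" by simp
  note meas [measurable] = measurable_compose[OF measurable_walk[OF assms(2)] this]
  then show ?thesis
    using bound unfolding walk_space_eq by (intro path.integrable_const_bound[of _ B]) auto
qed

text \<open>With the holding times frozen, the steps contribute \<open>c\<close> to the power of the
  number of jumps; averaging over the holding times evaluates the Poisson generating function at
  \<open>c\<close>.\<close>

lemma integral_walk:
  fixes f :: "(nat \<Rightarrow> int) \<Rightarrow> real"
  assumes bound: "\<And>z. \<bar>f z\<bar> \<le> B"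
    and step: "\<And>z. z \<in> Omega N \<Longrightarrow> (\<integral>s. f (z \<otimes>\<^bsub>G\<^esub> s) \<partial>step_law N r) = c * f z"
    and "x \<in> Omega N" and "t \<ge> 0"
  shows "(\<integral>\<omega>. f (walk N x t \<omega>) \<partial>walk_space N r) = exp (- ((1 - c) * t)) * f x"
proof -
  have "(\<integral>\<omega>. f (walk N x t \<omega>) \<partial>walk_space N r)
    = (\<integral>\<tau>. (\<integral>\<eta>. f (skeleton N x \<eta> (jumps \<tau> t)) \<partial>steps.S) \<partial>holding.S)"
    using integrable_walk[of f B x t] assms
    by (subst path.integral_snd) (auto simp: walk_space_eq walk_def split_beta')
  also have "\<dots> = (\<integral>\<tau>. c ^ jumps \<tau> t * f x \<partial>holding.S)"
    by (simp add: integral_skeleton[OF bound step \<open>x \<in> Omega N\<close>])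
  also have "\<dots> = exp (- ((1 - c) * t)) * f x"
    by (simp add: integral_power_jumps[OF \<open>t \<ge> 0\<close>])
  finally show ?thesis .
qed

text \<open>The point mass at \<open>y\<close> is \<open>unif 0\<close> translated to
  \<open>y\<close>. It telescopes into eigenfunctions with remainder \<open>unif k\<close>, whose
  expectation is at most N^(-k), so taking expectations mode by mode gives the series.\<close>

lemma walk_trans_sums:
  assumes x: "x \<in> Omega N" and y: "y \<in> Omega N" and t: "t \<ge> 0"
  shows "(\<lambda>i. exp (- (decay i * t)) * eigenfun i (inv\<^bsub>G\<^esub> y \<otimes>\<^bsub>G\<^esub> x)) sums walk_trans N r t x y"
proof -
  let ?W = "walk_space N r"
  let ?f = "\<lambda>i z. eigenfun i (inv\<^bsub>G\<^esub> y \<otimes>\<^bsub>G\<^esub> z)"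
  let ?u = "\<lambda>k z. unif k (inv\<^bsub>G\<^esub> y \<otimes>\<^bsub>G\<^esub> z)"
  \<comment> \<open>Steps multiply on the right, so left translation by the inverse of
    \<open>y\<close> preserves the eigenvalue.\<close>
  have step: "(\<integral>s. ?f i (z \<otimes>\<^bsub>G\<^esub> s) \<partial>step_law N r) = (1 - decay i) * ?f i z" if z: "z \<in> Omega N" for i z
  proof -
    have "(\<integral>s. ?f i (z \<otimes>\<^bsub>G\<^esub> s) \<partial>step_law N r)
        = (\<integral>s. eigenfun i ((inv\<^bsub>G\<^esub> y \<otimes>\<^bsub>G\<^esub> z) \<otimes>\<^bsub>G\<^esub> s) \<partial>step_law N r)"
      using y z by (intro Bochner_Integration.integral_cong refl) (simp add: m_assoc)
    then show ?thesis
      using y z by (simp add: integral_eigenfun_step)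
  qed
  have int_f: "integrable ?W (\<lambda>\<omega>. ?f i (walk N x t \<omega>))"
    and int_u: "integrable ?W (\<lambda>\<omega>. ?u i (walk N x t \<omega>))" for i
    using abs_eigenfun_le unif_bounds
    by (auto intro!: integrable_walk x)
  have expect_f: "(\<integral>\<omega>. ?f i (walk N x t \<omega>) \<partial>?W) = exp (- (decay i * t)) * ?f i x" for i
    using integral_walk[of "?f i", OF abs_eigenfun_le step x t] by simp
  have telescope: "(\<Sum>i<k. ?f i z) + ?u k z = (if z = y then 1 else 0)" if z: "z \<in> Omega N" for z k
  proof (induction k)
    case 0
    have "inv\<^bsub>G\<^esub> y \<otimes>\<^bsub>G\<^esub> z = origin N \<longleftrightarrow> z = y"
      using y z inv_solve_left[of "origin N" y z] by auto
    then show ?case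
      using y z by (simp add: unif_def hnorm_0_iff)
  qed (simp add: eigenfun_def)
  have in_Omega: "walk N x t \<omega> \<in> Omega N" if "\<omega> \<in> space ?W" for \<omega>
    using measurable_space[OF measurable_walk[OF x] that] by simp
  have partial: "(\<Sum>i<k. exp (- (decay i * t)) * ?f i x)
      = walk_trans N r t x y - (\<integral>\<omega>. ?u k (walk N x t \<omega>) \<partial>?W)" for k
  proof -
    have "walk_trans N r t x y = (\<integral>\<omega>. indicator {\<omega> \<in> space ?W. walk N x t \<omega> = y} \<omega> \<partial>?W)"
      by (simp add: walk_trans_def) (rule arg_cong[where f = "measure ?W"], auto)
    also have "\<dots> = (\<integral>\<omega>. (\<Sum>i<k. ?f i (walk N x t \<omega>)) + ?u k (walk N x t \<omega>) \<partial>?W)"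
      by (intro Bochner_Integration.integral_cong refl) (simp add: telescope[OF in_Omega] indicator_def)
    also have "\<dots> = (\<Sum>i<k. exp (- (decay i * t)) * ?f i x) + (\<integral>\<omega>. ?u k (walk N x t \<omega>) \<partial>?W)"
      using int_f int_u by (simp add: expect_f)
    finally show ?thesis by simp
  qed
  have "(\<lambda>k. \<integral>\<omega>. ?u k (walk N x t \<omega>) \<partial>?W) \<longlonglongrightarrow> 0"
  proof (rule tendsto_sandwich)
    show "\<forall>\<^sub>F k in sequentially. 0 \<le> (\<integral>\<omega>. ?u k (walk N x t \<omega>) \<partial>?W)"
      by (simp add: unif_bounds)
    have "(\<integral>\<omega>. ?u k (walk N x t \<omega>) \<partial>?W) \<le> 1 / real N ^ k" for k
      using int_u[of k] unfolding walk_space_eq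
      by (intro path.integral_le_const) (auto simp: unif_bounds)
    then show "\<forall>\<^sub>F k in sequentially. (\<integral>\<omega>. ?u k (walk N x t \<omega>) \<partial>?W) \<le> (1 / real N) ^ k"
      by (simp add: power_divide)
    show "(\<lambda>k. (1 / real N) ^ k) \<longlonglongrightarrow> 0"
      using N_ge_2 by (intro LIMSEQ_power_zero) simp
  qed simp
  then have "(\<lambda>k. walk_trans N r t x y - (\<integral>\<omega>. ?u k (walk N x t \<omega>) \<partial>?W)) \<longlonglongrightarrow> walk_trans N r t x y - 0"
    by (intro tendsto_intros)
  then show ?thesis
    by (simp add: sums_def partial)
qed

end

section \<open>Potentials\<close>

lemma has_bochner_integral_Gamma_exp:
  fixes \<zeta> h :: real
  assumes "\<zeta> > 0" "h > 0"
  shows "has_bochner_integral lborel (\<lambda>s. indicator {0..} s * (s powr (\<zeta> - 1) * exp (- (h * s))))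
    (Gamma \<zeta> * h powr (- \<zeta>))"
proof -
  have "has_bochner_integral lborel (\<lambda>s. indicator {0..} s * s powr (\<zeta> - 1) / exp s) (Gamma \<zeta>)"
    using assms Gamma_conv_nn_integral_real[OF assms(1)] Gamma_real_pos[OF assms(1)]
    by (intro has_bochner_integral_nn_integral) (auto simp: indicator_def)
  \<comment> \<open>Substitution of \<open>h * s\<close> in Euler's integral; the summand 0 is the
    shift of the affine change of variables. The Jacobian 1 / h and the factor
    \<open>h powr (1 - \<zeta>)\<close> combine to \<open>h powr (- \<zeta>)\<close>.\<close>
  then have "has_bochner_integral lborel
      (\<lambda>s. indicator {0..} (0 + h * s) * (0 + h * s) powr (\<zeta> - 1) / exp (0 + h * s)) (Gamma \<zeta> /\<^sub>R \<bar>h\<bar>)"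
    using assms by (subst lborel_has_bochner_integral_real_affine_iff[of h _ _ 0, symmetric]) auto
  then have "has_bochner_integral lborel
      (\<lambda>s. h powr (1 - \<zeta>) * (indicator {0..} (0 + h * s) * (0 + h * s) powr (\<zeta> - 1) / exp (0 + h * s)))
      (h powr (1 - \<zeta>) * (Gamma \<zeta> /\<^sub>R \<bar>h\<bar>))"
    by (rule has_bochner_integral_mult_right)
  moreover have "h powr (1 - \<zeta>) * (indicator {0..} (0 + h * s) * (0 + h * s) powr (\<zeta> - 1) / exp (0 + h * s))
      = indicator {0..} s * (s powr (\<zeta> - 1) * exp (- (h * s)))" for s
  proof -
    have "h powr (1 - \<zeta>) * (h * s) powr (\<zeta> - 1) = s powr (\<zeta> - 1)" if "s \<ge> 0"
      using assms that by (simp add: powr_mult powr_diff field_simps)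
    then show ?thesis
      using assms by (auto simp: indicator_def exp_minus field_simps zero_le_mult_iff)
  qed
  moreover have "h powr (1 - \<zeta>) * (Gamma \<zeta> /\<^sub>R \<bar>h\<bar>) = Gamma \<zeta> * h powr (- \<zeta>)"
    using assms by (simp add: powr_diff powr_minus field_simps)
  ultimately show ?thesis by (simp only:)
qed

lemma nn_integral_Gamma_exp:
  fixes \<zeta> h :: real
  assumes "\<zeta> > 0" "h > 0"
  shows "(\<integral>\<^sup>+ s\<in>{0..}. ennreal (s powr (\<zeta> - 1) * exp (- (h * s))) \<partial>lborel)
    = ennreal (Gamma \<zeta> * h powr (- \<zeta>))"
proof -
  have "(\<integral>\<^sup>+ s\<in>{0..}. ennreal (s powr (\<zeta> - 1) * exp (- (h * s))) \<partial>lborel)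
    = (\<integral>\<^sup>+ s. ennreal (indicator {0..} s * (s powr (\<zeta> - 1) * exp (- (h * s)))) \<partial>lborel)"
    by (intro nn_integral_cong) (auto simp: indicator_def)
  also have "\<dots> = ennreal (Gamma \<zeta> * h powr (- \<zeta>))"
    using has_bochner_integral_Gamma_exp[OF assms]
    by (subst nn_integral_eq_integral) (auto simp: has_bochner_integral_iff)
  finally show ?thesis .
qed

text \<open>For positive \<open>h\<close> this is the lower incomplete Gamma function at
  \<open>h * t\<close>, rescaled by \<open>h powr (- \<mu>)\<close>.\<close>

definition lower_Gamma_exp :: "real \<Rightarrow> real \<Rightarrow> real \<Rightarrow> real" where
  "lower_Gamma_exp \<mu> h t = (LINT s:{0..t}|lborel. s powr (\<mu> - 1) * exp (- (h * s)))"

lemma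
  fixes \<mu> h t :: real
  assumes "\<mu> > 0" "h > 0" "t > 0"
  shows set_integrable_lower_Gamma_exp:
      "set_integrable lborel {0..t} (\<lambda>s. s powr (\<mu> - 1) * exp (- (h * s)))"
    and lower_Gamma_exp_nonneg: "lower_Gamma_exp \<mu> h t \<ge> 0"
    and lower_Gamma_exp_le_Gamma: "lower_Gamma_exp \<mu> h t \<le> Gamma \<mu> * h powr (- \<mu>)"
    and lower_Gamma_exp_le_powr: "lower_Gamma_exp \<mu> h t \<le> t powr \<mu> / \<mu>"
    and lower_Gamma_exp_ge:
      "lower_Gamma_exp \<mu> h t \<ge> Gamma \<mu> * h powr (- \<mu>) * (1 - \<mu> / (h * t))"
proof -
  let ?f = "\<lambda>\<zeta> s. s powr (\<zeta> - 1) * exp (- (h * s)) :: real"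
  note full = has_bochner_integral_Gamma_exp[OF _ assms(2)]
  have int_full: "integrable lborel (\<lambda>s. indicator {0..} s * ?f \<zeta> s)"
    and full_eq: "(\<integral>s. indicator {0..} s * ?f \<zeta> s \<partial>lborel) = Gamma \<zeta> * h powr (- \<zeta>)" if "\<zeta> > 0" for \<zeta>
    using full[OF that] by (auto simp: has_bochner_integral_iff)
  have "set_integrable lborel {0..} (?f \<mu>)"
    using int_full[OF assms(1)] by (simp add: set_integrable_def)
  then show int: "set_integrable lborel {0..t} (?f \<mu>)"
    by (rule set_integrable_subset) auto
  then have int': "integrable lborel (\<lambda>s. indicator {0..t} s * ?f \<mu> s)"
    by (simp add: set_integrable_def)
  have eq: "lower_Gamma_exp \<mu> h t = (\<integral>s. indicator {0..t} s * ?f \<mu> s \<partial>lborel)"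
    by (simp add: lower_Gamma_exp_def set_lebesgue_integral_def)
  show "lower_Gamma_exp \<mu> h t \<ge> 0"
    unfolding eq by (intro Bochner_Integration.integral_nonneg) simp
  show "lower_Gamma_exp \<mu> h t \<le> Gamma \<mu> * h powr (- \<mu>)"
    unfolding eq full_eq[OF assms(1), symmetric]
    by (intro integral_mono int' int_full assms) (auto simp: indicator_def)
  show "lower_Gamma_exp \<mu> h t \<le> t powr \<mu> / \<mu>"
  proof -
    have "((\<lambda>s. s powr (\<mu> - 1)) has_integral (t powr (\<mu> - 1 + 1) / (\<mu> - 1 + 1))) {0..t}"
      using assms by (intro has_integral_powr_from_0) auto
    then have nn: "(\<integral>\<^sup>+s. ennreal (indicator {0..t} s * s powr (\<mu> - 1)) \<partial>lborel) = ennreal (t powr \<mu> / \<mu>)"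
      by (subst nn_integral_has_integral_lebesgue) auto
    have "has_bochner_integral lborel (\<lambda>s. indicator {0..t} s * s powr (\<mu> - 1)) (t powr \<mu> / \<mu>)"
      using assms nn by (intro has_bochner_integral_nn_integral) auto
    then have pw: "integrable lborel (\<lambda>s. indicator {0..t} s * s powr (\<mu> - 1))"
      "(\<integral>s. indicator {0..t} s * s powr (\<mu> - 1) \<partial>lborel) = t powr \<mu> / \<mu>"
      by (auto simp: has_bochner_integral_iff)
    show ?thesis
      unfolding eq pw(2)[symmetric]
      using assms by (intro integral_mono int' pw) (auto simp: indicator_def mult_left_le)
  qed
  \<comment> \<open>A Markov-type bound: beyond \<open>t\<close> the factor s / t exceeds 1, so the
    missing tail is at most 1 / t times the full integral with exponent raised by one.
    \<open>Gamma_plus1\<close> turns this into the relative error \<mu> / (h t).\<close>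
  have "Gamma \<mu> * h powr (- \<mu>)
      \<le> (\<integral>s. indicator {0..t} s * ?f \<mu> s + (indicator {0..} s * ?f (\<mu> + 1) s) / t \<partial>lborel)"
    unfolding full_eq[OF assms(1), symmetric]
  proof (intro integral_mono int_full assms Bochner_Integration.integrable_add int' integrable_divide)
    show "indicator {0..} s * ?f \<mu> s
        \<le> indicator {0..t} s * ?f \<mu> s + (indicator {0..} s * ?f (\<mu> + 1) s) / t" for s
    proof (cases "s > t")
      case True
      then have "s powr (\<mu> - 1) * 1 \<le> s powr (\<mu> - 1) * (s / t)"
        using assms by (intro mult_left_mono) auto
      also have "\<dots> = s powr \<mu> / t"
        using True assms by (simp add: powr_diff)
      finally have "s powr (\<mu> - 1) * exp (- (h * s)) \<le> (s powr \<mu> / t) * exp (- (h * s))"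
        by (intro mult_right_mono) auto
      then show ?thesis
        using True assms by (simp add: indicator_def)
    qed (use assms in \<open>auto simp: indicator_def\<close>)
  qed (use assms in auto)
  also have "\<dots> = lower_Gamma_exp \<mu> h t + Gamma (\<mu> + 1) * h powr (- (\<mu> + 1)) / t"
    using int' int_full[of "\<mu> + 1"] full_eq[of "\<mu> + 1"] assms by (simp add: eq)
  also have "Gamma (\<mu> + 1) * h powr (- (\<mu> + 1)) / t = Gamma \<mu> * h powr (- \<mu>) * (\<mu> / (h * t))"
    using assms Gamma_plus1[of \<mu>] by (simp add: powr_diff powr_minus field_simps powr_add nonpos_Ints_def)
  finally show "lower_Gamma_exp \<mu> h t \<ge> Gamma \<mu> * h powr (- \<mu>) * (1 - \<mu> / (h * t))"
    by (simp add: right_diff_distrib)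
qed

lemma semigroup_op_finite:
  assumes "\<phi> \<in> test_funs S"
  shows "semigroup_op S p t \<phi> x = (\<Sum>y\<in>{y \<in> S. \<phi> y \<noteq> 0}. p t x y * \<phi> y)"
proof -
  have "semigroup_op S p t \<phi> x = (\<Sum>\<^sub>\<infinity>y\<in>{y \<in> S. \<phi> y \<noteq> 0}. p t x y * \<phi> y)"
    unfolding semigroup_op_def by (intro infsum_cong_neutral) auto
  then show ?thesis
    using assms by (simp add: test_funs_def)
qed

section \<open>Potentials as sums over modes\<close>

context hierarchical_walk
begin

text \<open>The value of \<open>eigenfun i\<close> at the origin, that is, the spectral mass of mode
  \<open>i\<close>.\<close>

definition weight :: "nat \<Rightarrow> real" where
  "weight i = (real N - 1) / real N ^ Suc i"

lemma weight_pos: "weight i > 0"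
  using N_ge_2 by (simp add: weight_def)

lemma weight_sums: "weight sums 1"
proof -
  have "(\<lambda>i. (real N - 1) / real N * (1 / real N) ^ i) sums ((real N - 1) / real N * (1 / (1 - 1 / real N)))"
    using N_ge_2 by (intro sums_mult geometric_sums) simp
  then show ?thesis
    using N_ge_2 by (simp add: weight_def[abs_def] field_simps)
qed

lemma weight_tail_sums: "(\<lambda>i. weight (i + k)) sums (1 / real N ^ k)"
  using sums_mult[OF weight_sums, of "1 / real N ^ k"]
  by (simp add: weight_def power_add field_simps)

lemma return_prob_sums:
  assumes "t \<ge> 0"
  shows "(\<lambda>i. weight i * exp (- (decay i * t))) sums walk_trans N r t (origin N) (origin N)"
  using walk_trans_sums[of "origin N" "origin N" t] assms
  by (simp add: eigenfun_inside hnorm_origin weight_def mult.commute)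

lemma walk_trans_le_return_prob:
  assumes "x \<in> Omega N" "y \<in> Omega N" "t \<ge> 0"
  shows "walk_trans N r t x y \<le> walk_trans N r t (origin N) (origin N)"
proof (rule sums_le[OF _ walk_trans_sums[OF assms] return_prob_sums[OF assms(3)]])
  fix i
  show "exp (- (decay i * t)) * eigenfun i (inv\<^bsub>G\<^esub> y \<otimes>\<^bsub>G\<^esub> x) \<le> weight i * exp (- (decay i * t))"
    unfolding mult.commute[of "weight i"] using abs_eigenfun_le[of i "inv\<^bsub>G\<^esub> y \<otimes>\<^bsub>G\<^esub> x"]
    by (intro mult_left_mono) (simp_all add: weight_def)
qed

text \<open>Modes from the norm of the difference on take their central value; each earlier one
  falls short of it by at most \<open>2 * weight i\<close>. The correction is a finite sum of
  exponentials, so its Gamma integrals are finite.\<close>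

lemma return_prob_le_walk_trans:
  assumes "x \<in> Omega N" "y \<in> Omega N" "t \<ge> 0"
  shows "walk_trans N r t (origin N) (origin N)
    \<le> walk_trans N r t x y + (\<Sum>i<hnorm (inv\<^bsub>G\<^esub> y \<otimes>\<^bsub>G\<^esub> x). 2 * weight i * exp (- (decay i * t)))"
proof -
  let ?w = "inv\<^bsub>G\<^esub> y \<otimes>\<^bsub>G\<^esub> x"
  have "(\<lambda>i. if i < hnorm ?w then 2 * weight i * exp (- (decay i * t)) else 0)
      sums (\<Sum>i<hnorm ?w. 2 * weight i * exp (- (decay i * t)))"
    using sums_If_finite_set[of "{..<hnorm ?w}" "\<lambda>i. 2 * weight i * exp (- (decay i * t))"] by simp
  note dominating = sums_add[OF walk_trans_sums[OF assms] this]
  show ?thesis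
  proof (rule sums_le[OF _ return_prob_sums[OF assms(3)] dominating])
    fix i
    show "weight i * exp (- (decay i * t)) \<le> exp (- (decay i * t)) * eigenfun i ?w
        + (if i < hnorm ?w then 2 * weight i * exp (- (decay i * t)) else 0)"
    proof (cases "i < hnorm ?w")
      case True
      have "- weight i \<le> eigenfun i ?w"
        using abs_eigenfun_le[of i ?w] by (simp add: weight_def)
      then have "weight i \<le> eigenfun i ?w + 2 * weight i" by simp
      then have "weight i * exp (- (decay i * t)) \<le> (eigenfun i ?w + 2 * weight i) * exp (- (decay i * t))"
        by (intro mult_right_mono) auto
      then show ?thesis using True by (simp add: algebra_simps)
    next
      case False
      then show ?thesis by (simp add: eigenfun_inside weight_def mult.commute)
    qed
  qed
qed

lemma walk_trans_nonneg: "walk_trans N r t x y \<ge> 0"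
  by (simp add: walk_trans_def)

text \<open>\<open>walk_trans\<close> is defined separately for each \<open>t\<close>; measurability
  in \<open>t\<close> is read off its series, which is available for nonnegative times.\<close>

lemma measurable_walk_trans:
  assumes "x \<in> Omega N" "y \<in> Omega N"
  shows "(\<lambda>t. ennreal (t powr a * walk_trans N r t x y) * indicator {0..} t) \<in> borel_measurable borel"
proof -
  have "(\<lambda>t. ennreal (t powr a * (\<Sum>i. exp (- (decay i * t)) * eigenfun i (inv\<^bsub>G\<^esub> y \<otimes>\<^bsub>G\<^esub> x))) * indicator {0..} t)
      \<in> borel_measurable borel"
    by measurable
  moreover have "ennreal (t powr a * walk_trans N r t x y) * indicator {0..} t
    = ennreal (t powr a * (\<Sum>i. exp (- (decay i * t)) * eigenfun i (inv\<^bsub>G\<^esub> y \<otimes>\<^bsub>G\<^esub> x))) * indicator {0..} t" for t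
    using walk_trans_sums[OF assms, of t] by (auto simp: indicator_def sums_iff)
  ultimately show ?thesis by simp
qed

text \<open>All modes have positive weight, so sum and integral are exchanged in
  \<open>ennreal\<close> whether or not the value is finite.\<close>

lemma nn_integral_return_prob:
  assumes "\<zeta> > 0"
  shows "(\<integral>\<^sup>+ t\<in>{0..}. ennreal (t powr (\<zeta> - 1) * walk_trans N r t (origin N) (origin N)) \<partial>lborel)
    = (\<Sum>i. ennreal (Gamma \<zeta> * (weight i * decay i powr (- \<zeta>))))"
proof -
  let ?f = "\<lambda>i t. t powr (\<zeta> - 1) * exp (- (decay i * t))"
  have "ennreal (t powr (\<zeta> - 1) * walk_trans N r t (origin N) (origin N)) * indicator {0..} t
      = (\<Sum>i. ennreal (weight i) * (ennreal (?f i t) * indicator {0..} t))" for t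
  proof (cases "t \<ge> 0")
    case True
    have sums: "(\<lambda>i. t powr (\<zeta> - 1) * (weight i * exp (- (decay i * t))))
        sums (t powr (\<zeta> - 1) * walk_trans N r t (origin N) (origin N))"
      by (intro sums_mult return_prob_sums True)
    have "(\<Sum>i. ennreal (weight i) * (ennreal (?f i t) * indicator {0..} t))
        = (\<Sum>i. ennreal (t powr (\<zeta> - 1) * (weight i * exp (- (decay i * t)))))"
      using True weight_pos by (simp add: ennreal_mult'[symmetric] less_imp_le mult_ac)
    also have "\<dots> = ennreal (t powr (\<zeta> - 1) * walk_trans N r t (origin N) (origin N))"
      using sums weight_pos by (intro suminf_ennreal_eq) (auto simp: less_imp_le)
    finally show ?thesis using True by simp
  qed simp
  then have "(\<integral>\<^sup>+ t\<in>{0..}. ennreal (t powr (\<zeta> - 1) * walk_trans N r t (origin N) (origin N)) \<partial>lborel)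
      = (\<integral>\<^sup>+ t. (\<Sum>i. ennreal (weight i) * (ennreal (?f i t) * indicator {0..} t)) \<partial>lborel)"
    by simp
  also have "\<dots> = (\<Sum>i. \<integral>\<^sup>+ t. ennreal (weight i) * (ennreal (?f i t) * indicator {0..} t) \<partial>lborel)"
    by (intro nn_integral_suminf) measurable
  also have "\<dots> = (\<Sum>i. ennreal (Gamma \<zeta> * (weight i * decay i powr (- \<zeta>))))"
  proof (intro suminf_cong)
    fix i
    have "(\<integral>\<^sup>+ t. ennreal (weight i) * (ennreal (?f i t) * indicator {0..} t) \<partial>lborel)
        = ennreal (weight i) * ennreal (Gamma \<zeta> * decay i powr (- \<zeta>))"
      by (subst nn_integral_cmult) (auto simp: nn_integral_Gamma_exp[OF assms decay_pos])
    then show "(\<integral>\<^sup>+ t. ennreal (weight i) * (ennreal (?f i t) * indicator {0..} t) \<partial>lborel)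
        = ennreal (Gamma \<zeta> * (weight i * decay i powr (- \<zeta>)))"
      using weight_pos[of i] by (simp add: ennreal_mult'[symmetric] mult_ac)
  qed
  finally show ?thesis .
qed

lemma nn_integral_return_prob_finite_iff:
  assumes "\<zeta> > 0"
  shows "(\<integral>\<^sup>+ t\<in>{0..}. ennreal (t powr (\<zeta> - 1) * walk_trans N r t (origin N) (origin N)) \<partial>lborel) < \<infinity>
    \<longleftrightarrow> summable (\<lambda>i. weight i * decay i powr (- \<zeta>))"
proof -
  have pos: "0 \<le> Gamma \<zeta> * (weight i * decay i powr (- \<zeta>))" for i
    using Gamma_real_pos[OF assms] weight_pos[of i] by simp
  have "(\<Sum>i. ennreal (Gamma \<zeta> * (weight i * decay i powr (- \<zeta>)))) < \<infinity>
      \<longleftrightarrow> summable (\<lambda>i. Gamma \<zeta> * (weight i * decay i powr (- \<zeta>)))"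
  proof
    assume "(\<Sum>i. ennreal (Gamma \<zeta> * (weight i * decay i powr (- \<zeta>)))) < \<infinity>"
    then show "summable (\<lambda>i. Gamma \<zeta> * (weight i * decay i powr (- \<zeta>)))"
      using pos by (intro summable_suminf_not_top) auto
  next
    assume "summable (\<lambda>i. Gamma \<zeta> * (weight i * decay i powr (- \<zeta>)))"
    then show "(\<Sum>i. ennreal (Gamma \<zeta> * (weight i * decay i powr (- \<zeta>)))) < \<infinity>"
      using ennreal_suminf_neq_top[OF _ pos] by (simp add: less_top)
  qed
  moreover have "Gamma \<zeta> \<noteq> 0"
    using Gamma_real_pos[OF assms] by simp
  ultimately show ?thesis
    by (simp add: nn_integral_return_prob[OF assms] summable_cmult_iff)
qed

text \<open>Since p_t(0,0) dominates every p_t(x,y), the semigroup applied to \<phi> is at most the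
  sum of \<phi> times p_t(0,0).\<close>

lemma potential_finite:
  assumes "\<zeta> > 0" and summable: "summable (\<lambda>i. weight i * decay i powr (- \<zeta>))"
    and \<phi>: "\<phi> \<in> test_funs (Omega N)" and x: "x \<in> Omega N"
  shows "potential (Omega N) (walk_trans N r) \<zeta> \<phi> x < \<infinity>"
proof -
  let ?A = "{y \<in> Omega N. \<phi> y \<noteq> 0}"
  let ?p = "\<lambda>t. walk_trans N r t (origin N) (origin N)"
  define C where "C = (\<Sum>y\<in>?A. \<phi> y)"
  have C: "C \<ge> 0" using \<phi> by (auto simp: C_def test_funs_def intro!: sum_nonneg)
  have bound: "semigroup_op (Omega N) (walk_trans N r) t \<phi> x \<le> C * ?p t" if "t \<ge> 0" for t
    unfolding semigroup_op_finite[OF \<phi>] C_def sum_distrib_right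
    using \<phi> that x by (intro sum_mono) (auto simp: test_funs_def mult.commute walk_trans_le_return_prob
        intro!: mult_right_mono)
  have "(\<integral>\<^sup>+ t\<in>{0..}. ennreal (t powr (\<zeta> - 1) * semigroup_op (Omega N) (walk_trans N r) t \<phi> x) \<partial>lborel)
      \<le> (\<integral>\<^sup>+ t. ennreal C * (ennreal (t powr (\<zeta> - 1) * ?p t) * indicator {0..} t) \<partial>lborel)"
  proof (rule nn_integral_mono)
    fix t
    show "ennreal (t powr (\<zeta> - 1) * semigroup_op (Omega N) (walk_trans N r) t \<phi> x) * indicator {0..} t
        \<le> ennreal C * (ennreal (t powr (\<zeta> - 1) * ?p t) * indicator {0..} t)"
    proof (cases "t \<ge> 0")
      case True
      then have "t powr (\<zeta> - 1) * semigroup_op (Omega N) (walk_trans N r) t \<phi> x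
          \<le> C * (t powr (\<zeta> - 1) * ?p t)"
        using mult_left_mono[OF bound[OF True], of "t powr (\<zeta> - 1)"] by (simp add: mult_ac)
      then show ?thesis
        using True C by (simp add: ennreal_mult'[symmetric] ennreal_leI)
    qed simp
  qed
  also have "\<dots> = ennreal C * (\<integral>\<^sup>+ t\<in>{0..}. ennreal (t powr (\<zeta> - 1) * ?p t) \<partial>lborel)"
    using measurable_walk_trans by (intro nn_integral_cmult) simp
  also have "\<dots> < \<infinity>"
    using nn_integral_return_prob_finite_iff[OF assms(1)] summable by (simp add: ennreal_mult_less_top)
  finally show ?thesis
    by (simp add: potential_def ennreal_mult_less_top)
qed

text \<open>A single point \<open>y\<close> of the support bounds the semigroup from below. By
  \<open>return_prob_le_walk_trans\<close> the divergent integral of p_t(0,0) exceeds that of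
  p_t(x,y) by a finite amount at most, so the latter diverges as well.\<close>

lemma potential_infinite:
  assumes "\<zeta> > 0" and not_summable: "\<not> summable (\<lambda>i. weight i * decay i powr (- \<zeta>))"
    and \<phi>: "\<phi> \<in> test_funs (Omega N)" and x: "x \<in> Omega N"
    and y: "y \<in> Omega N" "\<phi> y \<noteq> 0"
  shows "potential (Omega N) (walk_trans N r) \<zeta> \<phi> x = \<infinity>"
proof -
  let ?p = "\<lambda>t. walk_trans N r t (origin N) (origin N)"
  let ?q = "\<lambda>t. walk_trans N r t x y"
  let ?k = "hnorm (inv\<^bsub>G\<^esub> y \<otimes>\<^bsub>G\<^esub> x)"
  let ?e = "\<lambda>i t. t powr (\<zeta> - 1) * exp (- (decay i * t))"
  have \<phi>y: "\<phi> y > 0" using \<phi> y by (force simp: test_funs_def)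
  have "(\<integral>\<^sup>+ t\<in>{0..}. ennreal (t powr (\<zeta> - 1) * ?p t) \<partial>lborel)
      \<le> (\<integral>\<^sup>+ t. ennreal (t powr (\<zeta> - 1) * ?q t) * indicator {0..} t
          + (\<Sum>i<?k. ennreal (2 * weight i) * (ennreal (?e i t) * indicator {0..} t)) \<partial>lborel)"
  proof (rule nn_integral_mono)
    fix t
    show "ennreal (t powr (\<zeta> - 1) * ?p t) * indicator {0..} t
      \<le> ennreal (t powr (\<zeta> - 1) * ?q t) * indicator {0..} t
          + (\<Sum>i<?k. ennreal (2 * weight i) * (ennreal (?e i t) * indicator {0..} t))"
    proof (cases "t \<ge> 0")
      case True
      have "t powr (\<zeta> - 1) * ?p t \<le> t powr (\<zeta> - 1) * (?q t + (\<Sum>i<?k. 2 * weight i * exp (- (decay i * t))))"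
        using return_prob_le_walk_trans[OF x y(1) True] by (intro mult_left_mono) auto
      also have "\<dots> = t powr (\<zeta> - 1) * ?q t + (\<Sum>i<?k. 2 * weight i * ?e i t)"
        by (simp add: distrib_left sum_distrib_left mult_ac)
      finally have "ennreal (t powr (\<zeta> - 1) * ?p t)
          \<le> ennreal (t powr (\<zeta> - 1) * ?q t + (\<Sum>i<?k. 2 * weight i * ?e i t))"
        by (rule ennreal_leI)
      also have "\<dots> = ennreal (t powr (\<zeta> - 1) * ?q t) + (\<Sum>i<?k. ennreal (2 * weight i) * ennreal (?e i t))"
        using weight_pos walk_trans_nonneg
        by (subst ennreal_plus) (auto simp: ennreal_mult'[symmetric] less_imp_le sum_nonneg simp flip: sum_ennreal)
      finally show ?thesis using True by simp
    qed simp
  qed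
  also have "\<dots> = (\<integral>\<^sup>+ t\<in>{0..}. ennreal (t powr (\<zeta> - 1) * ?q t) \<partial>lborel)
      + (\<Sum>i<?k. ennreal (2 * weight i) * ennreal (Gamma \<zeta> * decay i powr (- \<zeta>)))"
    using measurable_walk_trans[OF x y(1)] nn_integral_Gamma_exp[OF assms(1) decay_pos]
    by (subst nn_integral_add) (auto simp: nn_integral_sum nn_integral_cmult)
  finally have le: "(\<integral>\<^sup>+ t\<in>{0..}. ennreal (t powr (\<zeta> - 1) * ?p t) \<partial>lborel)
    \<le> (\<integral>\<^sup>+ t\<in>{0..}. ennreal (t powr (\<zeta> - 1) * ?q t) \<partial>lborel)
      + (\<Sum>i<?k. ennreal (2 * weight i) * ennreal (Gamma \<zeta> * decay i powr (- \<zeta>)))" .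
  have return_inf: "(\<integral>\<^sup>+ t\<in>{0..}. ennreal (t powr (\<zeta> - 1) * ?p t) \<partial>lborel) = \<infinity>"
    using nn_integral_return_prob_finite_iff[OF assms(1)] not_summable by (auto simp: less_top[symmetric])
  have "(\<Sum>i<?k. ennreal (2 * weight i) * ennreal (Gamma \<zeta> * decay i powr (- \<zeta>))) \<noteq> \<infinity>"
    by (simp add: ennreal_mult_eq_top_iff)
  with le have inf: "(\<integral>\<^sup>+ t\<in>{0..}. ennreal (t powr (\<zeta> - 1) * ?q t) \<partial>lborel) = \<infinity>"
    unfolding return_inf by (simp only: infinity_ennreal_def top_unique ennreal_add_eq_top) simp
  have "\<infinity> = ennreal (\<phi> y) * (\<integral>\<^sup>+ t\<in>{0..}. ennreal (t powr (\<zeta> - 1) * ?q t) \<partial>lborel)"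
    using \<phi>y inf by (simp add: ennreal_mult_top)
  also have "\<dots> = (\<integral>\<^sup>+ t. ennreal (\<phi> y) * (ennreal (t powr (\<zeta> - 1) * ?q t) * indicator {0..} t) \<partial>lborel)"
    using measurable_walk_trans[OF x y(1)] by (intro nn_integral_cmult[symmetric]) simp
  also have "\<dots> \<le> (\<integral>\<^sup>+ t\<in>{0..}. ennreal (t powr (\<zeta> - 1) * semigroup_op (Omega N) (walk_trans N r) t \<phi> x) \<partial>lborel)"
  proof (rule nn_integral_mono)
    fix t
    have "?q t * \<phi> y \<le> semigroup_op (Omega N) (walk_trans N r) t \<phi> x"
      unfolding semigroup_op_finite[OF \<phi>]
      using \<phi> y walk_trans_nonneg
      by (intro member_le_sum[of y _ "\<lambda>y. walk_trans N r t x y * \<phi> y"]) (auto simp: test_funs_def)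
    then have "t powr (\<zeta> - 1) * (?q t * \<phi> y) \<le> t powr (\<zeta> - 1) * semigroup_op (Omega N) (walk_trans N r) t \<phi> x"
      by (rule mult_left_mono) simp
    then have "\<phi> y * (t powr (\<zeta> - 1) * ?q t) \<le> t powr (\<zeta> - 1) * semigroup_op (Omega N) (walk_trans N r) t \<phi> x"
      by (simp only: mult_ac)
    then show "ennreal (\<phi> y) * (ennreal (t powr (\<zeta> - 1) * ?q t) * indicator {0..} t)
      \<le> ennreal (t powr (\<zeta> - 1) * semigroup_op (Omega N) (walk_trans N r) t \<phi> x) * indicator {0..} t"
      using \<phi>y by (auto simp: indicator_def ennreal_mult'[symmetric] intro!: ennreal_leI)
  qed
  finally show ?thesis
    using Gamma_real_pos[OF assms(1)] by (simp add: potential_def top_unique ennreal_mult_top)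
qed

text \<open>Replacing the exponential by 1 bounds the integral of mode \<open>i\<close> by
  \<open>weight i\<close> times a number independent of \<open>i\<close>; this summable majorant
  permits termwise integration.\<close>

lemma incomplete_potential_sums:
  assumes "\<mu> > 0" "t > 0"
  shows "(\<lambda>i. weight i * lower_Gamma_exp \<mu> (decay i) t / Gamma \<mu>)
    sums incomplete_potential (walk_trans N r) (origin N) \<mu> t"
proof -
  let ?p = "\<lambda>s. walk_trans N r s (origin N) (origin N)"
  define f where "f i s = indicator {0..t} s * (weight i * (s powr (\<mu> - 1) * exp (- (decay i * s))))" for i s
  have int: "integrable lborel (f i)" for i
    using set_integrable_lower_Gamma_exp[OF assms(1) decay_pos assms(2), of i]
    by (simp add: f_def[abs_def] set_integrable_def mult.left_commute[of _ "weight i"])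
  have integral_f: "(\<integral>s. f i s \<partial>lborel) = weight i * lower_Gamma_exp \<mu> (decay i) t" for i
    by (simp add: f_def lower_Gamma_exp_def set_lebesgue_integral_def mult.left_commute[of _ "weight i"])
  have f_nonneg: "0 \<le> f i s" for i s
    using weight_pos[of i] by (simp add: f_def)
  have f_sums: "(\<lambda>i. f i s) sums (indicator {0..t} s * (s powr (\<mu> - 1) * ?p s))" for s
  proof (cases "s \<in> {0..t}")
    case True
    have "(\<lambda>i. s powr (\<mu> - 1) * (weight i * exp (- (decay i * s)))) sums (s powr (\<mu> - 1) * ?p s)"
      using True by (intro sums_mult return_prob_sums) auto
    then show ?thesis using True by (simp add: f_def mult_ac)
  qed (simp add: f_def)
  have "(\<lambda>i. \<integral>s. f i s \<partial>lborel) sums (\<integral>s. (\<Sum>i. f i s) \<partial>lborel)"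
  proof (rule sums_integral[OF int])
    show "AE s in lborel. summable (\<lambda>i. norm (f i s))"
      using f_sums f_nonneg by (auto simp: sums_iff)
    have "summable (\<lambda>i. weight i * (t powr \<mu> / \<mu>))"
      using weight_sums by (intro summable_mult2) (simp add: sums_iff)
    moreover have "norm (\<integral>s. norm (f i s) \<partial>lborel) \<le> weight i * (t powr \<mu> / \<mu>)" for i
    proof -
      have "weight i * lower_Gamma_exp \<mu> (decay i) t \<le> weight i * (t powr \<mu> / \<mu>)"
        using weight_pos[of i] by (intro mult_left_mono lower_Gamma_exp_le_powr decay_pos assms) auto
      then show ?thesis
        using lower_Gamma_exp_nonneg[OF assms(1) decay_pos assms(2), of i] f_nonneg weight_pos[of i]
        by (simp add: integral_f)
    qed
    ultimately show "summable (\<lambda>i. \<integral>s. norm (f i s) \<partial>lborel)"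
      by (rule summable_comparison_test'[of _ 0])
  qed
  then have "(\<lambda>i. weight i * lower_Gamma_exp \<mu> (decay i) t)
      sums (LINT s:{0..t}|lborel. s powr (\<mu> - 1) * ?p s)"
    using f_sums by (simp add: integral_f sums_iff set_lebesgue_integral_def)
  from sums_divide[OF this, of "Gamma \<mu>"] show ?thesis
    by (simp add: incomplete_potential_def)
qed

end

section \<open>Asymptotics of the critical potential\<close>

lemma summable_powr_geometric:
  fixes x :: real
  assumes "0 < x" "x < 1"
  shows "summable (\<lambda>i. real (i + 1) powr b * x ^ i)"
proof (rule summable_comparison_test_bigo)
  \<comment> \<open>One factor \<open>y ^ i\<close> absorbs the power of \<open>i + 1\<close>, the
    other keeps the series geometric.\<close>
  define y where "y = sqrt x"
  have y: "0 < y" "y < 1" "x = y * y"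
    using assms by (simp_all add: y_def)
  show "summable (\<lambda>i. norm (y ^ i))"
    using y by (simp add: summable_geometric)
  have "(\<lambda>i. real (i + 1) powr b * y ^ i) \<in> O(\<lambda>_. 1)"
    using y by real_asymp
  then have "(\<lambda>i. (real (i + 1) powr b * y ^ i) * y ^ i) \<in> O(\<lambda>i. 1 * y ^ i)"
    by (rule landau_o.big.mult) simp
  then show "(\<lambda>i. real (i + 1) powr b * x ^ i) \<in> O(\<lambda>i. y ^ i)"
    by (simp add: y(3) power_mult_distrib mult.assoc)
qed

lemma summable_limit_comparison:
  fixes u v :: "nat \<Rightarrow> real"
  assumes "(\<lambda>n. u n / v n) \<longlonglongrightarrow> c" "c \<noteq> 0"
    and "\<And>n. u n > 0" "\<And>n. v n > 0"
  shows "summable u \<longleftrightarrow> summable v"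
proof
  have "u \<in> O(v)"
    using assms by (intro bigoI_tendsto[of _ _ c]) (auto simp: less_imp_neq[symmetric])
  moreover assume "summable v"
  ultimately show "summable u"
    using assms by (intro summable_comparison_test_bigo[of v u]) (simp_all add: less_imp_le)
next
  have "(\<lambda>n. v n / u n) \<longlonglongrightarrow> inverse c"
    using tendsto_inverse[OF assms(1,2)] by simp
  then have "v \<in> O(u)"
    using assms by (intro bigoI_tendsto[of _ _ "inverse c"]) (auto simp: less_imp_neq[symmetric])
  moreover assume "summable u"
  ultimately show "summable v"
    using assms by (intro summable_comparison_test_bigo[of u v]) (simp_all add: less_imp_le)
qed

text \<open>From some \<open>M\<close> on, \<open>a i\<close> is within \<open>e / 2 * b i\<close>
  of \<open>c * b i\<close>. The earlier indices contribute a constant \<open>K\<close>, which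
  becomes negligible once the partial sums of \<open>b\<close> exceed 2 K / e.\<close>

lemma Stolz_Cesaro_sum:
  fixes a b :: "nat \<Rightarrow> real"
  assumes b_pos: "\<And>n. b n > 0"
    and b_diverges: "filterlim (\<lambda>n. \<Sum>i<n. b i) at_top sequentially"
    and ratio: "(\<lambda>n. a n / b n) \<longlonglongrightarrow> c"
  shows "(\<lambda>n. (\<Sum>i<n. a i) / (\<Sum>i<n. b i)) \<longlonglongrightarrow> c"
proof (rule tendstoI)
  fix e :: real
  assume "e > 0"
  obtain M where M: "\<bar>a n / b n - c\<bar> < e / 2" if "n \<ge> M" for n
    using tendstoD[OF ratio, of "e / 2"] \<open>e > 0\<close> by (auto simp: eventually_sequentially dist_real_def)
  define K where "K = (\<Sum>i<M. \<bar>a i - c * b i\<bar>)"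
  have "K \<ge> 0" by (simp add: K_def sum_nonneg)
  have tail: "\<bar>a i - c * b i\<bar> \<le> e / 2 * b i" if "i \<ge> M" for i
  proof -
    have "\<bar>a i - c * b i\<bar> = \<bar>a i / b i - c\<bar> * b i"
      using b_pos[of i] by (simp add: abs_if field_simps)
    also have "\<dots> \<le> e / 2 * b i"
      using M[OF that] b_pos[of i] by (intro mult_right_mono) auto
    finally show ?thesis .
  qed
  have bound: "\<bar>(\<Sum>i<n. a i) - c * (\<Sum>i<n. b i)\<bar> \<le> K + e / 2 * (\<Sum>i<n. b i)" for n
  proof -
    have "\<bar>(\<Sum>i<n. a i) - c * (\<Sum>i<n. b i)\<bar> = \<bar>\<Sum>i<n. a i - c * b i\<bar>"
      by (simp add: sum_subtractf sum_distrib_left)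
    also have "\<dots> \<le> (\<Sum>i<n. \<bar>a i - c * b i\<bar>)"
      by (rule sum_abs)
    also have "\<dots> \<le> (\<Sum>i<n. (if i < M then \<bar>a i - c * b i\<bar> else 0) + e / 2 * b i)"
      using tail b_pos \<open>e > 0\<close> by (intro sum_mono) (auto simp: less_imp_le)
    also have "\<dots> = (\<Sum>i\<in>{..<n} \<inter> {..<M}. \<bar>a i - c * b i\<bar>) + e / 2 * (\<Sum>i<n. b i)"
      by (simp add: sum.distrib sum_distrib_left sum.inter_restrict lessThan_def)
    also have "(\<Sum>i\<in>{..<n} \<inter> {..<M}. \<bar>a i - c * b i\<bar>) \<le> K"
      unfolding K_def by (intro sum_mono2) auto
    finally show ?thesis by simp
  qed
  have "\<forall>\<^sub>F n in sequentially. (\<Sum>i<n. b i) > 2 * K / e"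
    using b_diverges by (simp add: filterlim_at_top_dense)
  then show "\<forall>\<^sub>F n in sequentially. dist ((\<Sum>i<n. a i) / (\<Sum>i<n. b i)) c < e"
  proof eventually_elim
    case (elim n)
    define B where "B = (\<Sum>i<n. b i)"
    have B: "B > 2 * K / e" using elim by (simp add: B_def)
    then have "B > 0" using \<open>K \<ge> 0\<close> \<open>e > 0\<close> by (meson divide_nonneg_pos le_less_trans mult_nonneg_nonneg zero_le_numeral)
    have "\<bar>(\<Sum>i<n. a i) / B - c\<bar> = \<bar>(\<Sum>i<n. a i) - c * B\<bar> / B"
      using \<open>B > 0\<close> by (simp add: abs_if field_simps)
    also have "\<dots> \<le> (K + e / 2 * B) / B"
      using bound[of n] \<open>B > 0\<close> by (intro divide_right_mono) (auto simp: B_def)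
    also have "\<dots> < e"
      using B \<open>B > 0\<close> \<open>e > 0\<close> by (simp add: field_simps)
    finally show ?case by (simp add: dist_real_def B_def)
  qed
qed

section \<open>Truncation at relaxed modes, and the degree, for a general walk\<close>

context hierarchical_walk
begin

text \<open>For positive \<zeta>, the contribution of mode \<open>i\<close> to the potential of the
  point mass at the origin, evaluated there; the Gamma factors have cancelled.\<close>

definition green_term :: "real \<Rightarrow> nat \<Rightarrow> real" where
  "green_term \<zeta> i = weight i * decay i powr (- \<zeta>)"

lemma green_term_pos: "green_term \<zeta> i > 0"
  using weight_pos[of i] decay_pos[of i] by (simp add: green_term_def)

text \<open>Modes \<open>i < n\<close> have relaxed by time \<open>t\<close> and modes \<open>i \<ge> n\<close> have not, where \<open>n\<close> is determined
  by \<open>x ^ n * t \<approx> 1\<close>; both errors are dominated by geometric series.\<close>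

lemma incomplete_potential_near_sum:
  assumes \<mu>: "\<mu> > 0" and x: "x = real N powr (- 1 / \<mu>)" and c: "c > 0"
    and decay: "\<And>i. decay i \<ge> c * x ^ i" and M: "\<And>i. green_term \<mu> i \<le> M"
    and t: "t \<ge> 1" and n: "n = nat \<lfloor>\<mu> / ln N * ln t\<rfloor>"
  shows "\<bar>incomplete_potential (walk_trans N r) (origin N) \<mu> t - (\<Sum>i<n. green_term \<mu> i)\<bar>
    \<le> M * (\<mu> / c) / (1 - x) + real N / (\<mu> * Gamma \<mu>)"
proof -
  define T where "T i = weight i * lower_Gamma_exp \<mu> (decay i) t / Gamma \<mu>" for i
  have \<Gamma>: "Gamma \<mu> > 0" using \<mu> by (rule Gamma_real_pos)
  have lnN: "ln (real N) > 0" using N_ge_2 by simp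
  have x01: "0 < x" "x < 1"
    using N_ge_2 \<mu> by (auto simp: x powr_less_one)
  have k_nonneg: "\<mu> / ln N * ln t \<ge> 0" using \<mu> lnN t by simp
  then have n_le: "real n \<le> \<mu> / ln N * ln t" and n_gt: "\<mu> / ln N * ln t < real n + 1"
    using n by linarith+
  have xn: "1 \<le> x ^ n * t"
  proof -
    have "real n / \<mu> * ln N \<le> ln t"
      using n_le \<mu> lnN by (simp add: field_simps)
    then have "exp (real n / \<mu> * ln N) \<le> exp (ln t)" by simp
    moreover have "exp (real n / \<mu> * ln N) * x ^ n = 1"
      using N_ge_2 by (simp add: x powr_def exp_of_nat_mult[symmetric] exp_add[symmetric] del: exp_of_nat_mult)
    ultimately show ?thesis
      using t x01 mult_right_mono[of "exp (real n / \<mu> * ln N)" t "x ^ n"] by (simp add: mult.commute)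
  qed
  \<comment> \<open>Rounding down loses less than one level, which costs the extra factor N.\<close>
  have Nn: "t powr \<mu> \<le> real N * real N ^ n"
  proof -
    have "\<mu> * ln t \<le> (real n + 1) * ln N"
      using n_gt lnN by (simp add: field_simps)
    then have "exp (\<mu> * ln t) \<le> exp (real (Suc n) * ln N)" by (simp add: add.commute)
    then show ?thesis
      using t N_ge_2 by (simp add: powr_def exp_of_nat_mult del: of_nat_Suc)
  qed
  have T_nonneg: "T i \<ge> 0" for i
    using \<Gamma> weight_pos[of i] lower_Gamma_exp_nonneg[OF \<mu> decay_pos, of t i] t by (simp add: T_def)
  have T_le: "T i \<le> green_term \<mu> i" for i
  proof -
    have "weight i * lower_Gamma_exp \<mu> (decay i) t \<le> weight i * (Gamma \<mu> * decay i powr (- \<mu>))"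
      using weight_pos[of i] t by (intro mult_left_mono lower_Gamma_exp_le_Gamma \<mu> decay_pos) auto
    then show ?thesis
      using \<Gamma> by (simp add: T_def green_term_def field_simps)
  qed
  \<comment> \<open>A relaxed mode has relative error at most \<mu> / (h t). Inserting the factor
    \<open>x ^ n * t\<close>, which is at least 1, trades the dependence on \<open>t\<close> for a
    geometric decay counted down from \<open>n\<close>.\<close>
  have T_ge: "green_term \<mu> i - T i \<le> M * (\<mu> / c) * x ^ (n - i)" if "i < n" for i
  proof -
    have "c * x ^ i * t > 0" using c x01 t by simp
    have "weight i * (Gamma \<mu> * decay i powr (- \<mu>) * (1 - \<mu> / (decay i * t)))
        \<le> weight i * lower_Gamma_exp \<mu> (decay i) t"
      using weight_pos[of i] t by (intro mult_left_mono lower_Gamma_exp_ge \<mu> decay_pos) auto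
    then have "green_term \<mu> i * (1 - \<mu> / (decay i * t)) \<le> T i"
      using \<Gamma> by (simp add: T_def green_term_def field_simps)
    then have "green_term \<mu> i - T i \<le> green_term \<mu> i * (\<mu> / (decay i * t))"
      by (simp add: right_diff_distrib)
    also have "\<dots> \<le> M * (\<mu> / (c * x ^ i * t))"
      using M[of i] green_term_pos[of \<mu> i] \<mu> decay[of i] t \<open>c * x ^ i * t > 0\<close> decay_pos[of i]
      by (intro mult_mono divide_left_mono mult_right_mono) auto
    also have "\<dots> \<le> M * (\<mu> / (c * x ^ i * t) * (x ^ n * t))"
    proof (intro mult_left_mono)
      show "\<mu> / (c * x ^ i * t) \<le> \<mu> / (c * x ^ i * t) * (x ^ n * t)"
        using mult_left_mono[OF xn, of "\<mu> / (c * x ^ i * t)"] \<mu> \<open>c * x ^ i * t > 0\<close> by simp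
      show "M \<ge> 0" using M[of i] green_term_pos[of \<mu> i] by simp
    qed
    also have "\<dots> = M * (\<mu> / c) * x ^ (n - i)"
      using that x01 t c by (simp add: power_diff)
    finally show ?thesis .
  qed
  have T_tail: "T i \<le> weight i * (t powr \<mu> / (\<mu> * Gamma \<mu>))" for i
  proof -
    have "weight i * lower_Gamma_exp \<mu> (decay i) t \<le> weight i * (t powr \<mu> / \<mu>)"
      using weight_pos[of i] t by (intro mult_left_mono lower_Gamma_exp_le_powr \<mu> decay_pos) auto
    then show ?thesis
      using \<Gamma> by (simp add: T_def field_simps)
  qed
  have sums: "T sums incomplete_potential (walk_trans N r) (origin N) \<mu> t"
    unfolding T_def[abs_def] using \<mu> t by (intro incomplete_potential_sums) auto
  then have split: "incomplete_potential (walk_trans N r) (origin N) \<mu> t = (\<Sum>i. T (i + n)) + (\<Sum>i<n. T i)"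
    using suminf_split_initial_segment[of T n] by (simp add: sums_iff)
  \<comment> \<open>The remaining weights add up to 1 / N^n, which cancels
    \<open>t powr \<mu>\<close> up to the factor in \<open>Nn\<close>.\<close>
  have "(\<Sum>i. T (i + n)) \<le> (\<Sum>i. weight (i + n) * (t powr \<mu> / (\<mu> * Gamma \<mu>)))"
    using sums weight_tail_sums[of n]
    by (intro suminf_le T_tail summable_ignore_initial_segment summable_mult2) (auto simp: sums_iff)
  also have "\<dots> = 1 / real N ^ n * (t powr \<mu> / (\<mu> * Gamma \<mu>))"
    by (rule sums_unique[symmetric, OF sums_mult2[OF weight_tail_sums]])
  also have "\<dots> \<le> 1 / real N ^ n * (real N * real N ^ n / (\<mu> * Gamma \<mu>))"
    using Nn \<mu> \<Gamma> by (intro mult_left_mono divide_right_mono) auto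
  also have "\<dots> = real N / (\<mu> * Gamma \<mu>)"
    using N_ge_2 by simp
  finally have tail: "(\<Sum>i. T (i + n)) \<le> real N / (\<mu> * Gamma \<mu>)" .
  have tail_nonneg: "(\<Sum>i. T (i + n)) \<ge> 0"
    using sums T_nonneg by (intro suminf_nonneg summable_ignore_initial_segment) (auto simp: sums_iff)
  have "(\<Sum>i<n. green_term \<mu> i) - (\<Sum>i<n. T i) \<le> (\<Sum>i<n. M * (\<mu> / c) * x ^ (n - i))"
    unfolding sum_subtractf[symmetric] by (intro sum_mono T_ge) simp
  also have "\<dots> = M * (\<mu> / c) * (\<Sum>i<n. x ^ (n - i))"
    by (simp only: sum_distrib_left)
  also have "(\<Sum>i<n. x ^ (n - i)) = (\<Sum>i<n. x ^ Suc (n - Suc i))"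
    by (intro sum.cong) (auto simp: Suc_diff_Suc)
  also have "\<dots> = (\<Sum>i<n. x ^ Suc i)"
    by (rule sum.nat_diff_reindex)
  also have "M * (\<mu> / c) * \<dots> \<le> M * (\<mu> / c) * (1 / (1 - x))"
  proof (rule mult_left_mono)
    have "(\<Sum>i<n. x ^ Suc i) \<le> (\<Sum>i<n. x ^ i)"
      using x01 by (intro sum_mono power_decreasing) auto
    also have "\<dots> \<le> (\<Sum>i. x ^ i)"
      using x01 by (intro sum_le_suminf summable_geometric) auto
    finally show "(\<Sum>i<n. x ^ Suc i) \<le> 1 / (1 - x)"
      using x01 by (simp add: suminf_geometric)
    show "M * (\<mu> / c) \<ge> 0"
      using M[of 0] green_term_pos[of \<mu> 0] \<mu> c by simp
  qed
  finally have head: "(\<Sum>i<n. green_term \<mu> i) - (\<Sum>i<n. T i) \<le> M * (\<mu> / c) / (1 - x)" by simp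
  have "(\<Sum>i<n. T i) \<le> (\<Sum>i<n. green_term \<mu> i)"
    by (intro sum_mono T_le)
  then show ?thesis
    using split head tail tail_nonneg by linarith
qed

lemma all_potentials_finite_iff:
  assumes "\<zeta> > 0"
  shows "(\<forall>\<phi>\<in>test_funs (Omega N). \<forall>x\<in>Omega N. potential (Omega N) (walk_trans N r) \<zeta> \<phi> x < \<infinity>)
    \<longleftrightarrow> summable (green_term \<zeta>)"
proof
  let ?\<delta> = "\<lambda>y. if y = origin N then 1 else 0 :: real"
  have \<delta>: "?\<delta> \<in> test_funs (Omega N)"
    by (auto simp: test_funs_def intro: finite_subset[of _ "{origin N}"])
  assume *: "\<forall>\<phi>\<in>test_funs (Omega N). \<forall>x\<in>Omega N. potential (Omega N) (walk_trans N r) \<zeta> \<phi> x < \<infinity>"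
  show "summable (green_term \<zeta>)"
  proof (rule ccontr)
    assume "\<not> summable (green_term \<zeta>)"
    then have "potential (Omega N) (walk_trans N r) \<zeta> ?\<delta> (origin N) = \<infinity>"
      using assms \<delta> by (intro potential_infinite[of _ _ _ "origin N"]) (auto simp: green_term_def[abs_def])
    then show False using * \<delta> one_closed by fastforce
  qed
next
  assume "summable (green_term \<zeta>)"
  then show "\<forall>\<phi>\<in>test_funs (Omega N). \<forall>x\<in>Omega N. potential (Omega N) (walk_trans N r) \<zeta> \<phi> x < \<infinity>"
    using potential_finite assms by (simp add: green_term_def[abs_def])
qed

lemma transience_degree_eqI:
  assumes "\<mu> > 0"
    and fin: "\<And>\<zeta>. 0 < \<zeta> \<Longrightarrow> \<zeta> < \<mu> \<Longrightarrow> summable (green_term \<zeta>)"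
    and inf: "\<And>\<zeta>. \<zeta> > \<mu> \<Longrightarrow> \<not> summable (green_term \<zeta>)"
  shows "transience_degree (Omega N) (walk_trans N r) = ereal (\<mu> - 1)"
proof -
  define S where "S = {\<zeta>. \<zeta> > -1 \<and> (\<forall>\<phi>\<in>test_funs (Omega N). \<forall>x\<in>Omega N.
    potential (Omega N) (walk_trans N r) (\<zeta> + 1) \<phi> x < \<infinity>)}"
  have S: "\<zeta> \<in> S \<longleftrightarrow> \<zeta> > -1 \<and> summable (green_term (\<zeta> + 1))" for \<zeta>
    unfolding S_def using all_potentials_finite_iff[of "\<zeta> + 1"] by auto
  have "Sup (ereal ` S) = ereal (\<mu> - 1)"
  proof (rule antisym)
    show "Sup (ereal ` S) \<le> ereal (\<mu> - 1)"
    proof (rule Sup_least)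
      fix z assume "z \<in> ereal ` S"
      then obtain \<zeta> where "z = ereal \<zeta>" "summable (green_term (\<zeta> + 1))" by (auto simp: S)
      then show "z \<le> ereal (\<mu> - 1)" using inf[of "\<zeta> + 1"] by force
    qed
    show "ereal (\<mu> - 1) \<le> Sup (ereal ` S)"
    proof (rule dense_le)
      fix z assume "z < ereal (\<mu> - 1)"
      \<comment> \<open>The maximum keeps the chosen exponent above -1, as the definition of the
        degree demands, and also covers \<open>z\<close> equal to minus infinity.\<close>
      then have "max z (ereal (-1)) < ereal (\<mu> - 1)" using \<open>\<mu> > 0\<close> by auto
      then obtain \<zeta> where \<zeta>: "max z (ereal (-1)) < ereal \<zeta>" "ereal \<zeta> < ereal (\<mu> - 1)"
        using ereal_dense2 by blast
      then have "\<zeta> \<in> S" using fin[of "\<zeta> + 1"] by (auto simp: S)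
      then have "ereal \<zeta> \<le> Sup (ereal ` S)" by (intro Sup_upper) auto
      then show "z \<le> Sup (ereal ` S)" using \<zeta> by (meson less_imp_le max_less_iff_conj order_trans)
    qed
  qed
  then show ?thesis by (simp add: transience_degree_def S_def)
qed

lemma has_degree_minus_iff:
  assumes "\<mu> > 0" and deg: "transience_degree (Omega N) (walk_trans N r) = ereal (\<mu> - 1)"
  shows "has_degree_minus (Omega N) (walk_trans N r) (\<mu> - 1) \<longleftrightarrow> \<not> summable (green_term \<mu>)"
proof
  assume *: "has_degree_minus (Omega N) (walk_trans N r) (\<mu> - 1)"
  let ?\<delta> = "\<lambda>y. if y = origin N then 1 else 0 :: real"
  have "?\<delta> \<in> test_funs (Omega N)"
    by (auto simp: test_funs_def intro: finite_subset[of _ "{origin N}"])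
  moreover have "\<exists>y\<in>Omega N. ?\<delta> y \<noteq> 0"
    by (rule bexI[of _ "origin N"]) auto
  ultimately have "\<forall>x\<in>Omega N. potential (Omega N) (walk_trans N r) \<mu> ?\<delta> x = \<infinity>"
    using * unfolding has_degree_minus_def by auto
  then show "\<not> summable (green_term \<mu>)"
    using all_potentials_finite_iff[OF assms(1)] \<open>?\<delta> \<in> test_funs (Omega N)\<close> one_closed by fastforce
next
  assume "\<not> summable (green_term \<mu>)"
  then show "has_degree_minus (Omega N) (walk_trans N r) (\<mu> - 1)"
    using potential_infinite[OF assms(1)] deg by (auto simp: has_degree_minus_def green_term_def[abs_def])
qed

end

section \<open>The walk with rates given by \<mu> and \<beta>\<close>

locale mu_walk = hierarchical +
  fixes \<mu> \<beta> :: real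
  assumes mu_pos: "\<mu> > 0" and beta_pos: "\<beta> > 0"
begin

definition scale :: real where "scale = real N powr (- 1 / \<mu>)"

definition rate :: "nat \<Rightarrow> real" where
  "rate = mu_rate \<mu> (\<lambda>j. real (j + 1) powr \<beta>) N"

text \<open>The unnormalised rate of norm \<open>i + 1\<close>; the normalising constant D is the
  reciprocal of its total sum.\<close>

definition profile :: "nat \<Rightarrow> real" where
  "profile i = real (i + 1) powr \<beta> * scale ^ i"

lemma scale_bounds: "0 < scale" "scale < 1"
  using N_ge_2 mu_pos by (auto simp: scale_def powr_less_one)

lemma profile_pos: "profile i > 0"
  using scale_bounds by (simp add: profile_def)

lemma summable_profile: "summable profile"
  unfolding profile_def[abs_def] by (intro summable_powr_geometric scale_bounds)

lemma scale_power: "scale ^ i = real N powr (- real i / \<mu>)"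
  using N_ge_2 by (simp add: scale_def powr_powr flip: powr_realpow)

lemma rate_Suc: "rate (Suc i) = profile i / (\<Sum>i. profile i)"
  by (simp add: rate_def mu_rate_def Let_def profile_def scale_power)

lemma suminf_profile_pos: "(\<Sum>i. profile i) > 0"
  using summable_profile profile_pos by (rule suminf_pos)

sublocale hierarchical_walk N rate
proof
  show "rate (Suc i) > 0" for i
    using profile_pos suminf_profile_pos by (simp add: rate_Suc)
  show "(\<lambda>i. rate (Suc i)) sums 1"
    unfolding rate_Suc using sums_divide[OF summable_sums[OF summable_profile], of "\<Sum>i. profile i"]
      suminf_profile_pos by simp
qed

text \<open>The geometric sum is the limiting ratio of the tail of \<open>profile\<close> from
  \<open>i\<close> on to \<open>profile i\<close>; 1 / (N - 1) comes from the last term of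
  \<open>decay\<close>, the denominator from normalisation.\<close>

definition decay_const :: real where
  "decay_const = (1 / (1 - scale) + 1 / (real N - 1)) / (\<Sum>i. profile i)"

lemma decay_const_pos: "decay_const > 0"
  using scale_bounds N_ge_2 suminf_profile_pos by (simp add: decay_const_def add_pos_pos)

lemma decay_div_profile:
  "decay i / profile i
    = ((\<Sum>k. (real (k + i + 1) / real (i + 1)) powr \<beta> * scale ^ k) + 1 / (real N - 1)) / (\<Sum>i. profile i)"
proof -
  let ?u = "\<lambda>k. (real (k + i + 1) / real (i + 1)) powr \<beta> * scale ^ k"
  have "(\<lambda>k. rate (Suc (k + i))) sums (1 - (\<Sum>k<i. rate (Suc k)))"
    using sums_split_initial_segment[OF r_sums, of i] by simp
  then have "(\<lambda>k. rate (Suc (k + i)) / (profile i / (\<Sum>i. profile i)))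
      sums ((1 - (\<Sum>k<i. rate (Suc k))) / (profile i / (\<Sum>i. profile i)))"
    by (rule sums_divide)
  moreover have "rate (Suc (k + i)) / (profile i / (\<Sum>i. profile i)) = ?u k" for k
    using suminf_profile_pos scale_bounds
    by (simp add: rate_Suc) (simp add: profile_def powr_divide power_add)
  ultimately have "(\<Sum>k. ?u k) = (1 - (\<Sum>k<i. rate (Suc k))) / (profile i / (\<Sum>i. profile i))"
    by (simp add: sums_iff)
  then show ?thesis
    using profile_pos[of i] suminf_profile_pos
    by (simp add: decay_def rate_Suc[of i] add_divide_distrib)
qed

lemma decay_asymp: "(\<lambda>i. decay i / profile i) \<longlonglongrightarrow> decay_const"
proof -
  let ?u = "\<lambda>k i. (real (k + i + 1) / real (i + 1)) powr \<beta> * scale ^ k"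
  have "(\<lambda>i. \<Sum>k. ?u k i) \<longlonglongrightarrow> (\<Sum>k. scale ^ k)"
  proof (intro tannerys_theorem[THEN conjunct2, THEN conjunct2])
    show "summable profile" by (rule summable_profile)
    have "(\<lambda>i. real (k + i + 1) / real (i + 1)) \<longlonglongrightarrow> 1" for k
      by real_asymp
    then have "(\<lambda>i. ?u k i) \<longlonglongrightarrow> 1 powr \<beta> * scale ^ k" for k
      by (intro tendsto_intros) auto
    then show "(\<lambda>i. ?u k i) \<longlonglongrightarrow> scale ^ k" for k by simp
    have "norm (?u k i) \<le> profile k" for k i
    proof -
      \<comment> \<open>The ratio 1 + k / (i + 1) is largest at i = 0, so \<open>profile\<close>
        itself is a summable majorant uniform in \<open>i\<close>.\<close>
      have "real (k + i + 1) / real (i + 1) \<le> real (k + 1)"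
        by (simp add: field_simps)
      then have "(real (k + i + 1) / real (i + 1)) powr \<beta> \<le> real (k + 1) powr \<beta>"
        using beta_pos by (intro powr_mono2) auto
      then show ?thesis
        using scale_bounds by (simp add: profile_def)
    qed
    then show "\<forall>\<^sub>F (k, i) in sequentially \<times>\<^sub>F sequentially. norm (?u k i) \<le> profile k"
      by (intro always_eventually) auto
  qed simp
  then show ?thesis
    unfolding decay_div_profile decay_const_def using scale_bounds suminf_profile_pos
    by (intro tendsto_intros) (simp_all add: suminf_geometric)
qed

text \<open>Keeps only the last term of \<open>decay\<close> and bounds the power of
  \<open>i + 1\<close> below by 1. The truncation estimate wants a bound valid for every
  \<open>i\<close>, while \<open>decay_asymp\<close> speaks of large \<open>i\<close> only.\<close>

lemma decay_ge_geometric: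
  obtains c where "c > 0" "\<And>i. decay i \<ge> c * scale ^ i"
proof
  define c where "c = (1 / (real N - 1)) / (\<Sum>i. profile i)"
  show "c > 0"
    using N_ge_2 suminf_profile_pos by (simp add: c_def)
  show "decay i \<ge> c * scale ^ i" for i
  proof -
    have "scale ^ i \<le> profile i"
      using beta_pos scale_bounds by (simp add: profile_def mult_le_cancel_right1 ge_one_powr_ge_zero)
    then have "c * scale ^ i \<le> c * profile i"
      using \<open>c > 0\<close> by simp
    also have "\<dots> = rate (Suc i) / (real N - 1)"
      by (simp add: c_def rate_Suc)
    also have "\<dots> \<le> decay i"
      using sum_r_le_1[of i] by (simp add: decay_def)
    finally show ?thesis .
  qed
qed

definition green_const :: "real \<Rightarrow> real" where
  "green_const \<zeta> = (real N - 1) / real N * decay_const powr (- \<zeta>)"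

lemma green_const_pos: "green_const \<zeta> > 0"
  using N_ge_2 decay_const_pos by (simp add: green_const_def)

text \<open>The geometric base combines N^(-1) from \<open>weight\<close> with N^(\<zeta> / \<mu>)
  from the power of \<open>scale\<close>; it is below, equal to or above 1 as \<zeta> is relative to
  \<mu>.\<close>

lemma green_term_asymp:
  "(\<lambda>i. green_term \<zeta> i / (real (i + 1) powr (- (\<beta> * \<zeta>)) * (real N powr (\<zeta> / \<mu> - 1)) ^ i))
    \<longlonglongrightarrow> green_const \<zeta>"
proof -
  have "green_term \<zeta> i / (real (i + 1) powr (- (\<beta> * \<zeta>)) * (real N powr (\<zeta> / \<mu> - 1)) ^ i)
      = (real N - 1) / real N * (decay i / profile i) powr (- \<zeta>)" for i
  proof -
    have "profile i powr (- \<zeta>) = real (i + 1) powr (- (\<beta> * \<zeta>)) * real N powr (real i * (\<zeta> / \<mu>))"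
      using scale_bounds N_ge_2 unfolding profile_def scale_power by (simp add: powr_mult powr_powr)
    moreover have "(real N powr (\<zeta> / \<mu> - 1)) ^ i = real N powr (real i * (\<zeta> / \<mu>)) / real N ^ i"
      using N_ge_2 by (simp add: powr_diff power_divide powr_powr mult.commute flip: powr_realpow)
    moreover have "(decay i / profile i) powr (- \<zeta>) = decay i powr (- \<zeta>) / profile i powr (- \<zeta>)"
      using decay_pos[of i] profile_pos[of i] by (simp add: powr_divide)
    ultimately show ?thesis
      using N_ge_2 by (simp add: green_term_def weight_def)
  qed
  then show ?thesis
    unfolding green_const_def using decay_const_pos
    by (simp only:) (intro tendsto_intros decay_asymp, simp)
qed

lemma summable_green_term_iff:
  "summable (green_term \<zeta>)
    \<longleftrightarrow> summable (\<lambda>i. real (i + 1) powr (- (\<beta> * \<zeta>)) * (real N powr (\<zeta> / \<mu> - 1)) ^ i)"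
  using N_ge_2 green_const_pos[of \<zeta>]
  by (intro summable_limit_comparison[OF green_term_asymp]) (auto simp: green_term_pos)

lemma summable_green_term_subcritical:
  assumes "\<zeta> < \<mu>"
  shows "summable (green_term \<zeta>)"
proof -
  have "real N powr (\<zeta> / \<mu> - 1) < real N powr 0"
    using N_ge_2 assms mu_pos by (intro powr_less_mono) auto
  then show ?thesis
    unfolding summable_green_term_iff using N_ge_2 by (intro summable_powr_geometric) auto
qed

lemma not_summable_green_term_supercritical:
  assumes "\<zeta> > \<mu>"
  shows "\<not> summable (green_term \<zeta>)"
proof
  assume summable: "summable (green_term \<zeta>)"
  define z where "z = real N powr (\<zeta> / \<mu> - 1)"
  have "real N powr 0 < z"
    unfolding z_def using N_ge_2 assms mu_pos by (intro powr_less_mono) auto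
  then have "z > 1" using N_ge_2 by simp
  then have "filterlim (\<lambda>i. real (i + 1) powr (- (\<beta> * \<zeta>)) * z ^ i) at_top sequentially"
    by real_asymp
  moreover have "(\<lambda>i. real (i + 1) powr (- (\<beta> * \<zeta>)) * z ^ i) \<longlonglongrightarrow> 0"
    using summable unfolding summable_green_term_iff z_def by (rule summable_LIMSEQ_zero)
  ultimately show False
    using not_tendsto_and_filterlim_at_infinity[OF sequentially_bot] filterlim_at_top_imp_at_infinity by blast
qed

lemma green_term_critical_asymp:
  "(\<lambda>i. green_term \<mu> i / real (i + 1) powr (- (\<beta> * \<mu>))) \<longlonglongrightarrow> green_const \<mu>"
  using green_term_asymp[of \<mu>] mu_pos N_ge_2 by simp

text \<open>At \<zeta> = \<mu> the geometric base is 1, which leaves the series of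
  i^(-\<beta>\<mu>).\<close>

lemma summable_green_term_critical_iff: "summable (green_term \<mu>) \<longleftrightarrow> \<beta> > 1 / \<mu>"
proof -
  have "summable (green_term \<mu>) \<longleftrightarrow> summable (\<lambda>i. real (Suc i) powr (- (\<beta> * \<mu>)))"
    using mu_pos N_ge_2 by (simp add: summable_green_term_iff)
  also have "\<dots> \<longleftrightarrow> \<beta> * \<mu> > 1"
    using summable_Suc_iff[of "\<lambda>i. real i powr (- (\<beta> * \<mu>))"] by (simp add: summable_real_powr_iff)
  finally show ?thesis
    using mu_pos by (simp add: field_simps)
qed

lemma green_term_critical_bounded:
  obtains M where "\<And>i. green_term \<mu> i \<le> M"
proof -
  have "(\<lambda>i. green_term \<mu> i / real (i + 1) powr (- (\<beta> * \<mu>)) * real (i + 1) powr (- (\<beta> * \<mu>)))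
      \<longlonglongrightarrow> green_const \<mu> * 0"
    using beta_pos mu_pos by (intro tendsto_mult green_term_critical_asymp) real_asymp
  then have "Bseq (green_term \<mu>)"
    by (intro convergent_imp_Bseq convergentI[of _ 0]) simp
  then show ?thesis
    using that by (auto simp: Bseq_def) (metis abs_le_D1)
qed

text \<open>For \<open>t\<close> at least 1, the largest \<open>n\<close> with
  \<open>scale ^ n * t\<close> at least 1.\<close>

definition level :: "real \<Rightarrow> nat" where
  "level t = nat \<lfloor>\<mu> / ln N * ln t\<rfloor>"

text \<open>The increments of \<open>L\<close> are asymptotic to d (n + 1)^(-\<beta>\<mu>), so
  Stolz-Cesaro compares the partial sums with \<open>L\<close>; \<open>e\<close> converts
  \<open>L\<close> at the level of \<open>t\<close> into \<phi>. As \<open>L\<close> is unbounded,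
  the bounded truncation error disappears.\<close>

lemma incomplete_potential_asymp:
  fixes L \<phi> :: "real \<Rightarrow> real"
  assumes L_0: "L 0 = 0" and L_inc: "\<And>n. L (real n) < L (real (Suc n))"
    and L_at_top: "filterlim (\<lambda>n. L (real n)) at_top sequentially"
    and L_diff: "(\<lambda>n. (L (real (Suc n)) - L (real n)) * real (n + 1) powr (\<beta> * \<mu>)) \<longlonglongrightarrow> d"
    and "d > 0"
    and L_level: "((\<lambda>t. L (real (level t)) / \<phi> t) \<longlongrightarrow> e) at_top" and "e > 0"
  shows "\<exists>C>0. incomplete_potential (walk_trans N rate) (origin N) \<mu> \<sim>[at_top] (\<lambda>t. C * \<phi> t)"
proof -
  let ?g = "incomplete_potential (walk_trans N rate) (origin N) \<mu>"
  let ?A = "\<lambda>n. \<Sum>i<n. green_term \<mu> i"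
  define C where "C = green_const \<mu> / d * e"
  have "C > 0" using \<open>d > 0\<close> \<open>e > 0\<close> green_const_pos by (simp add: C_def)
  have lnN: "ln (real N) > 0" using N_ge_2 by simp
  have level: "filterlim level sequentially at_top"
    unfolding level_def using divide_pos_pos[OF mu_pos lnN] by real_asymp
  have sum_L: "(\<Sum>i<n. L (real (Suc i)) - L (real i)) = L (real n)" for n
    using sum_lessThan_telescope[of "\<lambda>i. L (real i)" n] L_0 by simp
  have "(\<lambda>n. ?A n / (\<Sum>i<n. L (real (Suc i)) - L (real i))) \<longlonglongrightarrow> green_const \<mu> / d"
  proof (rule Stolz_Cesaro_sum)
    have "(\<lambda>i. green_term \<mu> i / real (i + 1) powr (- (\<beta> * \<mu>))
        / ((L (real (Suc i)) - L (real i)) * real (i + 1) powr (\<beta> * \<mu>))) \<longlonglongrightarrow> green_const \<mu> / d"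
      using \<open>d > 0\<close> by (intro tendsto_divide green_term_critical_asymp L_diff) auto
    moreover have "green_term \<mu> i / real (i + 1) powr (- (\<beta> * \<mu>))
        / ((L (real (Suc i)) - L (real i)) * real (i + 1) powr (\<beta> * \<mu>))
      = green_term \<mu> i / (L (real (Suc i)) - L (real i))" for i
      by (simp add: powr_minus)
    ultimately show "(\<lambda>i. green_term \<mu> i / (L (real (Suc i)) - L (real i))) \<longlonglongrightarrow> green_const \<mu> / d"
      by (simp only:)
  qed (use L_inc L_at_top sum_L in auto)
  then have main: "((\<lambda>t. ?A (level t) / L (real (level t))) \<longlongrightarrow> green_const \<mu> / d) at_top"
    unfolding sum_L by (rule filterlim_compose[OF _ level])
  have error: "((\<lambda>t. (?g t - ?A (level t)) / L (real (level t))) \<longlongrightarrow> 0) at_top"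
  proof -
    obtain c where c: "c > 0" "\<And>i. decay i \<ge> c * scale ^ i" using decay_ge_geometric by blast
    obtain M where M: "\<And>i. green_term \<mu> i \<le> M" using green_term_critical_bounded by blast
    define B where "B = M * (\<mu> / c) / (1 - scale) + real N / (\<mu> * Gamma \<mu>)"
    have "\<bar>?g t - ?A (level t)\<bar> \<le> B" if "t \<ge> 1" for t
      unfolding B_def using incomplete_potential_near_sum[OF mu_pos scale_def c M that] level_def by simp
    then have "\<forall>\<^sub>F t in at_top. norm (?g t - ?A (level t)) \<le> B"
      by (intro eventually_mono[OF eventually_ge_at_top[of 1]]) simp
    then have bounded: "Bfun (\<lambda>t. ?g t - ?A (level t)) at_top"
      by (rule BfunI)
    have "filterlim (\<lambda>t. L (real (level t))) at_infinity at_top"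
      using filterlim_compose[OF L_at_top level] by (rule filterlim_at_top_imp_at_infinity)
    then have "((\<lambda>t. inverse (L (real (level t)))) \<longlongrightarrow> 0) at_top"
      by (rule filterlim_compose[OF tendsto_inverse_0])
    then have "Zfun (\<lambda>t. inverse (L (real (level t)))) at_top"
      by (simp only: tendsto_Zfun_iff diff_zero)
    from bounded_bilinear.Bfun_prod_Zfun[OF bounded_bilinear_mult bounded this] show ?thesis
      by (simp only: tendsto_Zfun_iff diff_zero divide_inverse)
  qed
  have "((\<lambda>t. (?A (level t) / L (real (level t)) + (?g t - ?A (level t)) / L (real (level t)))
      * (L (real (level t)) / \<phi> t)) \<longlongrightarrow> (green_const \<mu> / d + 0) * e) at_top"
    by (intro tendsto_mult tendsto_add main error L_level)
  then have "((\<lambda>t. (?A (level t) / L (real (level t)) + (?g t - ?A (level t)) / L (real (level t)))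
      * (L (real (level t)) / \<phi> t) / C) \<longlongrightarrow> C / C) at_top"
    using \<open>C > 0\<close> by (intro tendsto_divide) (auto simp: C_def)
  moreover have "\<forall>\<^sub>F t in at_top. L (real (level t)) > 0"
    using filterlim_compose[OF L_at_top level] by (simp add: filterlim_at_top_dense)
  then have "\<forall>\<^sub>F t in at_top. (?A (level t) / L (real (level t)) + (?g t - ?A (level t)) / L (real (level t)))
      * (L (real (level t)) / \<phi> t) / C = ?g t / (C * \<phi> t)"
    by eventually_elim (simp add: add_divide_distrib[symmetric])
  ultimately have "((\<lambda>t. ?g t / (C * \<phi> t)) \<longlongrightarrow> 1) at_top"
    using \<open>C > 0\<close> by (simp cong: filterlim_cong)
  then have "?g \<sim>[at_top] (\<lambda>t. C * \<phi> t)"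
    by (rule asymp_equivI')
  with \<open>C > 0\<close> show ?thesis by (intro exI[of _ C] conjI)
qed

lemma incomplete_potential_asymp_lnln:
  assumes "\<beta> = 1 / \<mu>"
  shows "\<exists>C>0. incomplete_potential (walk_trans N rate) (origin N) \<mu> \<sim>[at_top] (\<lambda>t. C * ln (ln t))"
\<comment> \<open>The shift by 1 gives \<open>L 0 = 0\<close>. The level is about \<mu> / ln N times
  ln t, and the outer logarithm makes that factor negligible, hence \<open>e = 1\<close>.\<close>
proof (rule incomplete_potential_asymp[where L = "\<lambda>y. ln (y + 1)" and d = 1 and e = 1])
  have k: "\<mu> / ln (real N) > 0" using mu_pos N_ge_2 by simp
  have "\<beta> * \<mu> = 1" using assms mu_pos by simp
  moreover have "(\<lambda>n. (ln (real (Suc n) + 1) - ln (real n + 1)) * real (n + 1)) \<longlonglongrightarrow> 1"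
    by real_asymp
  ultimately show "(\<lambda>n. (ln (real (Suc n) + 1) - ln (real n + 1)) * real (n + 1) powr (\<beta> * \<mu>)) \<longlonglongrightarrow> 1"
    by simp
  show "filterlim (\<lambda>n. ln (real n + 1)) at_top sequentially"
    by real_asymp
  show "((\<lambda>t. ln (real (level t) + 1) / ln (ln t)) \<longlongrightarrow> 1) at_top"
    unfolding level_def using k by real_asymp
qed auto

lemma incomplete_potential_asymp_powr:
  assumes "\<beta> < 1 / \<mu>"
  shows "\<exists>C>0. incomplete_potential (walk_trans N rate) (origin N) \<mu>
    \<sim>[at_top] (\<lambda>t. C * ln t powr (1 - \<beta> * \<mu>))"
proof -
  define s where "s = \<beta> * \<mu>"
  have s: "0 < s" "s < 1"
    using assms mu_pos beta_pos by (auto simp: s_def field_simps)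
  have k: "\<mu> / ln (real N) > 0" using mu_pos N_ge_2 by simp
  show ?thesis
    unfolding s_def[symmetric]
  \<comment> \<open>Here \<open>d\<close> comes from the derivative of the power, and
    \<open>e\<close> is the factor \<mu> / ln N between the level and ln t, raised to the same
    power.\<close>
  proof (rule incomplete_potential_asymp[where L = "\<lambda>y. y powr (1 - s)" and d = "1 - s"
        and e = "(\<mu> / ln (real N)) powr (1 - s)"])
    show "real n powr (1 - s) < real (Suc n) powr (1 - s)" for n
      using s by (intro powr_less_mono2) auto
    show "filterlim (\<lambda>n. real n powr (1 - s)) at_top sequentially"
      using s by real_asymp
    show "(\<lambda>n. (real (Suc n) powr (1 - s) - real n powr (1 - s)) * real (n + 1) powr (\<beta> * \<mu>)) \<longlonglongrightarrow> 1 - s"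
      unfolding s_def[symmetric] using s by real_asymp
    show "((\<lambda>t. real (level t) powr (1 - s) / ln t powr (1 - s))
        \<longlongrightarrow> (\<mu> / ln (real N)) powr (1 - s)) at_top"
      unfolding level_def using s k by real_asymp
  qed (use s k in auto)
qed

end

theorem corollary3p3p3:
  fixes N :: nat and \<mu> \<beta> :: real
  assumes "N \<ge> 2" and "\<mu> > 0" and "\<beta> > 0"
  defines "p \<equiv> mu_trans \<mu> (\<lambda>j. real (j + 1) powr \<beta>) N"
  defines "g \<equiv> incomplete_potential p (origin N) \<mu>"
  shows "transience_degree (Omega N) p = ereal (\<mu> - 1)
    \<and> (has_degree_minus (Omega N) p (\<mu> - 1) \<longleftrightarrow> \<beta> \<le> 1 / \<mu>)
    \<and> (\<beta> = 1 / \<mu> \<longrightarrow> (\<exists>C>0. g \<sim>[at_top] (\<lambda>t. C * ln (ln t))))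
    \<and> (\<beta> < 1 / \<mu> \<longrightarrow> (\<exists>C>0. g \<sim>[at_top] (\<lambda>t. C * (ln t) powr (1 - \<beta> * \<mu>))))"
proof -
  interpret mu_walk N \<mu> \<beta>
    by unfold_locales (use assms in auto)
  have p: "p = walk_trans N rate"
    by (simp add: p_def mu_trans_def rate_def)
  have degree: "transience_degree (Omega N) (walk_trans N rate) = ereal (\<mu> - 1)"
    using mu_pos summable_green_term_subcritical not_summable_green_term_supercritical
    by (rule transience_degree_eqI)
  then have "has_degree_minus (Omega N) (walk_trans N rate) (\<mu> - 1) \<longleftrightarrow> \<beta> \<le> 1 / \<mu>"
    using has_degree_minus_iff[OF mu_pos] summable_green_term_critical_iff by auto
  then show ?thesis
    using degree incomplete_potential_asymp_lnln incomplete_potential_asymp_powr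
    unfolding g_def p by blast
qed

end
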